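(* Let $m\ge1$ and let $M\subset\mathbb{C}^2$ be a real-analytic hypersurface given, in (formal or holomorphic) coordinates $(z,w)$, $w=u+iv$, by $v=\frac12u^m\bigl(\epsilon|z|^2+\sum_{k,l\ge2}h_{kl}(u)z^k\bar z^l\bigr)$, $\epsilon=\pm1$. Whether $M$ is of Fuchsian type does not depend on the choice of such (formal or holomorphic) coordinates: if $M$ is given by an equation of the same form in another such coordinate system, it is of Fuchsian type in one system if and only if it is of Fuchsian type in the other.
   Context: $\operatorname{ord}$ denotes the vanishing order at $0$ of a power series in one variable (the zero series has order $\infty$). $M$ is of Fuchsian type (in the given coordinates) if its coefficient functions satisfy: $\operatorname{ord}h_{22}\ge m-1$; $\operatorname{ord}h_{23}\ge2m-2$; $\operatorname{ord}h_{33}\ge2m-2$; $\operatorname{ord}h_{2l}\ge2m-l+2$ for $4\le l\le2m+1$; $\operatorname{ord}h_{kl}\ge2m-k-l+5$ for $k,l\ge3$, $7\le k+l\le2m+4$. *)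

theory Defs
  imports Complex_Main "HOL-Computational_Algebra.Formal_Power_Series" "HOL-Library.Extended_Nat"
begin

text \<open>Formal power series in three variables (z, zbar, u): coefficient of z^a zbar^b u^c.\<close>
type_synonym ser3 = "nat \<Rightarrow> nat \<Rightarrow> nat \<Rightarrow> complex"
text \<open>Formal power series in two complex variables (z, w): coefficient of z^a w^b.\<close>
type_synonym ser2 = "nat \<Rightarrow> nat \<Rightarrow> complex"

definition mul3 :: "ser3 \<Rightarrow> ser3 \<Rightarrow> ser3" where
  "mul3 A B = (\<lambda>a b c. \<Sum>i\<le>a. \<Sum>j\<le>b. \<Sum>k\<le>c. A i j k * B (a - i) (b - j) (c - k))"

definition one3 :: ser3 where
  "one3 = (\<lambda>a b c. if a = 0 \<and> b = 0 \<and> c = 0 then 1 else 0)"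

fun pow3 :: "ser3 \<Rightarrow> nat \<Rightarrow> ser3" where
  "pow3 A 0 = one3"
| "pow3 A (Suc n) = mul3 A (pow3 A n)"

text \<open>Substitution of series without constant term into a 2-variable series.\<close>
definition comp2 :: "ser2 \<Rightarrow> ser3 \<Rightarrow> ser3 \<Rightarrow> ser3" where
  "comp2 g P Q = (\<lambda>a b c. \<Sum>(i, j) \<in> {(i, j). i + j \<le> a + b + c}.
      g i j * mul3 (pow3 P i) (pow3 Q j) a b c)"

text \<open>Substitution of series without constant term into a 3-variable series.\<close>
definition comp3 :: "ser3 \<Rightarrow> ser3 \<Rightarrow> ser3 \<Rightarrow> ser3 \<Rightarrow> ser3" where
  "comp3 r P Q R = (\<lambda>a b c. \<Sum>(i, j, k) \<in> {(i, j, k). i + j + k \<le> a + b + c}.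
      r i j k * mul3 (pow3 P i) (mul3 (pow3 Q j) (pow3 R k)) a b c)"

text \<open>Complex conjugation of a series in (z, zbar, u), u real.\<close>
definition cnj3 :: "ser3 \<Rightarrow> ser3" where
  "cnj3 A = (\<lambda>a b c. cnj (A b a c))"

definition Zs :: ser3 where "Zs = (\<lambda>a b c. if a = 1 \<and> b = 0 \<and> c = 0 then 1 else 0)"
definition Us :: ser3 where "Us = (\<lambda>a b c. if a = 0 \<and> b = 0 \<and> c = 1 then 1 else 0)"

text \<open>The formal map (z,w) \<mapsto> (f(z,w), g(z,w)) is an invertible formal change of
  coordinates at 0 sending the formal hypersurface v = r(z, zbar, u) into the formal
  hypersurface v = r'(z, zbar, u): on M, w = u + i r, and the image point must satisfy
  Im g = r'(f, conj f, Re g) identically in (z, zbar, u).\<close>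
definition maps_hyp :: "ser2 \<Rightarrow> ser2 \<Rightarrow> ser3 \<Rightarrow> ser3 \<Rightarrow> bool" where
  "maps_hyp f g r r' \<longleftrightarrow>
     f 0 0 = 0 \<and> g 0 0 = 0 \<and> f 1 0 * g 0 1 - f 0 1 * g 1 0 \<noteq> 0 \<and>
     (let W = (\<lambda>a b c. Us a b c + \<i> * r a b c);
          F = comp2 f Zs W;
          G = comp2 g Zs W;
          ReG = (\<lambda>a b c. (G a b c + cnj3 G a b c) / 2);
          ImG = (\<lambda>a b c. (G a b c - cnj3 G a b c) / (2 * \<i>))
      in ImG = comp3 r' F (cnj3 F) ReG)"

definition real3 :: "ser3 \<Rightarrow> bool" where
  "real3 r \<longleftrightarrow> (\<forall>a b c. r b a c = cnj (r a b c))"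

definition convergent3 :: "ser3 \<Rightarrow> bool" where
  "convergent3 r \<longleftrightarrow> (\<exists>R>0. \<forall>a b c. norm (r a b c) * R ^ (a + b + c) \<le> 1)"

text \<open>Coefficients h_{kl}(u) of the normal form; hermitian so that the right-hand side is real.\<close>
definition hermitian_h :: "(nat \<Rightarrow> nat \<Rightarrow> complex fps) \<Rightarrow> bool" where
  "hermitian_h h \<longleftrightarrow> (\<forall>k l j. fps_nth (h l k) j = cnj (fps_nth (h k l) j))"

definition nf_ser :: "nat \<Rightarrow> int \<Rightarrow> (nat \<Rightarrow> nat \<Rightarrow> complex fps) \<Rightarrow> ser3" where
  "nf_ser m eps h = (\<lambda>a b c.
      (if a = 1 \<and> b = 1 \<and> c = m then of_int eps / 2 else 0)
    + (if 2 \<le> a \<and> 2 \<le> b \<and> m \<le> c then fps_nth (h a b) (c - m) / 2 else 0))"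

definition ord_fps :: "complex fps \<Rightarrow> enat" where
  "ord_fps p = (if p = 0 then \<infinity> else enat (subdegree p))"

definition fuchsian :: "nat \<Rightarrow> (nat \<Rightarrow> nat \<Rightarrow> complex fps) \<Rightarrow> bool" where
  "fuchsian m h \<longleftrightarrow>
     ord_fps (h 2 2) \<ge> enat (m - 1) \<and>
     ord_fps (h 2 3) \<ge> enat (2 * m - 2) \<and>
     ord_fps (h 3 3) \<ge> enat (2 * m - 2) \<and>
     (\<forall>l. 4 \<le> l \<and> l \<le> 2 * m + 1 \<longrightarrow> ord_fps (h 2 l) \<ge> enat (2 * m + 2 - l)) \<and>
     (\<forall>k l. 3 \<le> k \<and> 3 \<le> l \<and> 7 \<le> k + l \<and> k + l \<le> 2 * m + 4 \<longrightarrow>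
        ord_fps (h k l) \<ge> enat (2 * m + 5 - k - l))"

end

(*
  Give z, zbar and u weight 1 and put d = m + 1.  In terms of the total degree, Fuchsian type says
  that no monomial z^a zbar^b u^c of low degree with a, b >= 2 occurs in the defining series, where
  the threshold is 2d+1 for a = b = 2, 3d for a + b = 5, 3d+1 for the other (2,b), (a,2) and (3,3),
  and 3d+2 otherwise.  Let n <= 3d+1 be the smallest degree of a violation in r or r'.  In the basic
  identity Im g(z, u + i r) = r'(f, conj f, Re g) one first reads off from the monomials with zbar-degree
  at most 1 that the low-degree coefficients of g (apart from powers of w) and of f (apart from the
  terms of degree at most 1 in z) vanish.  Then, in degree n and outside the allowed monomials, the left
  side is g_01 r, while on the right only the violations of r' contribute, through the linear
  parts of f and g.  So violations of r in degree n force violations of r', and conversely a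
  violation of r' that is maximal in the degree in (z, zbar) would survive on the right.
*)
theory Submission
  imports Defs
begin

section \<open>Coefficients of products and substitutions\<close>

lemma mul3_nonzeroE:
  assumes "mul3 A B a b c \<noteq> 0"
  obtains i j k where "i \<le> a" "j \<le> b" "k \<le> c" "A i j k \<noteq> 0" "B (a - i) (b - j) (c - k) \<noteq> 0"
proof -
  have "\<exists>i\<le>a. (\<Sum>j\<le>b. \<Sum>k\<le>c. A i j k * B (a - i) (b - j) (c - k)) \<noteq> 0"
    using assms unfolding mul3_def by (meson atMost_iff sum.neutral)
  then obtain i where i: "i \<le> a" "(\<Sum>j\<le>b. \<Sum>k\<le>c. A i j k * B (a - i) (b - j) (c - k)) \<noteq> 0" by blast
  then obtain j where j: "j \<le> b" "(\<Sum>k\<le>c. A i j k * B (a - i) (b - j) (c - k)) \<noteq> 0"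
    by (meson atMost_iff sum.neutral)
  then obtain k where "k \<le> c" "A i j k * B (a - i) (b - j) (c - k) \<noteq> 0"
    by (meson atMost_iff sum.neutral)
  then show thesis using that i j by auto
qed

text \<open>Extracts a coefficient when degree counting leaves one index triple; uniqueness is asked
  only of terms in which both factors are nonzero.\<close>

lemma mul3_single:
  assumes "i \<le> a" "j \<le> b" "k \<le> c"
    and single: "\<And>i' j' k'. i' \<le> a \<Longrightarrow> j' \<le> b \<Longrightarrow> k' \<le> c \<Longrightarrow> A i' j' k' \<noteq> 0 \<Longrightarrow>
      B (a - i') (b - j') (c - k') \<noteq> 0 \<Longrightarrow> i' = i \<and> j' = j \<and> k' = k"
  shows "mul3 A B a b c = A i j k * B (a - i) (b - j) (c - k)"
proof -
  define t where "t i' j' k' = A i' j' k' * B (a - i') (b - j') (c - k')" for i' j' k'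
  have z: "t i' j' k' = (if i' = i \<and> j' = j \<and> k' = k then t i j k else 0)"
    if "i' \<in> {..a}" "j' \<in> {..b}" "k' \<in> {..c}" for i' j' k'
  proof (cases "i' = i \<and> j' = j \<and> k' = k")
    case False
    then have "A i' j' k' = 0 \<or> B (a - i') (b - j') (c - k') = 0"
      using single[of i' j' k'] that by blast
    then show ?thesis using False by (auto simp only: t_def mult_zero_left mult_zero_right if_False)
  qed simp
  have if_sum: "(\<Sum>x\<in>S. if P then F x else 0) = (if P then sum F S else 0)"
    for P and F :: "nat \<Rightarrow> complex" and S by simp
  have "mul3 A B a b c = (\<Sum>i'\<le>a. \<Sum>j'\<le>b. \<Sum>k'\<le>c. t i' j' k')"
    unfolding mul3_def t_def ..
  also have "\<dots> = (\<Sum>i'\<le>a. \<Sum>j'\<le>b. \<Sum>k'\<le>c.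
      if i' = i \<and> j' = j \<and> k' = k then t i j k else 0)"
    by (intro sum.cong refl z)
  also have "\<dots> = (\<Sum>i'\<le>a. if i' = i then \<Sum>j'\<le>b. if j' = j then \<Sum>k'\<le>c.
      if k' = k then t i j k else 0 else 0 else 0)"
    by (simp only: if_sum if_if_eq_conj[symmetric])
  also have "\<dots> = t i j k"
    using assms(1-3) by (simp add: sum.delta)
  also have "\<dots> = A i j k * B (a - i) (b - j) (c - k)" unfolding t_def ..
  finally show ?thesis .
qed

lemma mul3_one3_right: "mul3 A one3 = A"
proof (intro ext)
  fix a b c
  have "mul3 A one3 a b c = A a b c * one3 (a - a) (b - b) (c - c)"
    by (rule mul3_single) (auto simp: one3_def split: if_splits)
  then show "mul3 A one3 a b c = A a b c" by (simp add: one3_def)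
qed

lemma pow3_Zs: "pow3 Zs i = (\<lambda>a b c. if a = i \<and> b = 0 \<and> c = 0 then 1 else 0)"
proof (induction i)
  case 0
  then show ?case by (simp add: one3_def)
next
  case (Suc i)
  show ?case
  proof (intro ext)
    fix a b c
    show "pow3 Zs (Suc i) a b c = (if a = Suc i \<and> b = 0 \<and> c = 0 then 1 else 0)"
    proof (cases "a = Suc i \<and> b = 0 \<and> c = 0")
      case True
      have "mul3 Zs (pow3 Zs i) a b c = Zs 1 0 0 * pow3 Zs i (a - 1) (b - 0) (c - 0)"
        unfolding Suc.IH
        by (rule mul3_single) (use True in \<open>auto simp: Zs_def split: if_splits\<close>)
      then show ?thesis using True unfolding pow3.simps Suc.IH by (simp add: Zs_def)
    next
      case False
      have "mul3 Zs (pow3 Zs i) a b c = 0"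
        unfolding Suc.IH
        by (rule ccontr, erule mul3_nonzeroE) (use False in \<open>auto simp: Zs_def split: if_splits\<close>)
      then show ?thesis using False by simp
    qed
  qed
qed

text \<open>Reduces a substitution with first argument z, such as f(z, W), to shifted powers of the
  second argument.\<close>

lemma mul3_pow3_Zs: "mul3 (pow3 Zs i) B a b c = (if i \<le> a then B (a - i) b c else 0)"
proof (cases "i \<le> a")
  case True
  have "mul3 (pow3 Zs i) B a b c = pow3 Zs i i 0 0 * B (a - i) (b - 0) (c - 0)"
    by (rule mul3_single) (use True in \<open>auto simp: pow3_Zs split: if_splits\<close>)
  then show ?thesis using True by (simp add: pow3_Zs)
next
  case False
  have "mul3 (pow3 Zs i) B a b c = 0"
    by (rule ccontr, erule mul3_nonzeroE) (use False in \<open>auto simp: pow3_Zs split: if_splits\<close>)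
  then show ?thesis using False by simp
qed

lemma finite_pairs_le: "finite {(i, j). i + j \<le> (w::nat)}"
  by (rule finite_subset[of _ "{..w} \<times> {..w}"]) auto

lemma finite_triples_le: "finite {(i, j, k). i + j + k \<le> (w::nat)}"
  by (rule finite_subset[of _ "{..w} \<times> {..w} \<times> {..w}"]) auto

lemma comp2_Zs_nonzeroE:
  assumes "comp2 g Zs Q a b c \<noteq> 0"
  obtains i j where "i \<le> a" "i + j \<le> a + b + c" "g i j \<noteq> 0" "pow3 Q j (a - i) b c \<noteq> 0"
proof -
  from assms obtain x where "x \<in> {(i, j). i + j \<le> a + b + c}"
    "(case x of (i, j) \<Rightarrow> g i j * mul3 (pow3 Zs i) (pow3 Q j) a b c) \<noteq> 0"
    unfolding comp2_def by (meson sum.not_neutral_contains_not_neutral)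
  then show thesis using that by (auto simp: mul3_pow3_Zs split: if_splits)
qed

lemma comp2_Zs_single:
  assumes "i \<le> a" "i + j \<le> a + b + c"
    and "\<And>i' j'. i' \<le> a \<Longrightarrow> i' + j' \<le> a + b + c \<Longrightarrow> g i' j' \<noteq> 0 \<Longrightarrow>
      pow3 Q j' (a - i') b c \<noteq> 0 \<Longrightarrow> i' = i \<and> j' = j"
  shows "comp2 g Zs Q a b c = g i j * pow3 Q j (a - i) b c"
proof -
  have "comp2 g Zs Q a b c = (\<Sum>x\<in>{(i, j)}. case x of (i, j) \<Rightarrow> g i j * mul3 (pow3 Zs i) (pow3 Q j) a b c)"
    unfolding comp2_def
  proof (rule sum.mono_neutral_right[OF finite_pairs_le])
    show "{(i, j)} \<subseteq> {(i, j). i + j \<le> a + b + c}" using assms(2) by simp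
    show "\<forall>x\<in>{(i, j). i + j \<le> a + b + c} - {(i, j)}.
        (case x of (i, j) \<Rightarrow> g i j * mul3 (pow3 Zs i) (pow3 Q j) a b c) = 0"
    proof (intro ballI, elim DiffE CollectE case_prodE, hypsubst, unfold case_prod_conv)
      fix i' j' assume "i' + j' \<le> a + b + c" "(i', j') \<notin> {(i, j)}"
      then have "i' \<le> a \<Longrightarrow> g i' j' = 0 \<or> pow3 Q j' (a - i') b c = 0"
        using assms(3)[of i' j'] by blast
      then show "g i' j' * mul3 (pow3 Zs i') (pow3 Q j') a b c = 0"
        by (simp add: mul3_pow3_Zs)
    qed
  qed
  then show ?thesis using assms(1) by (simp add: mul3_pow3_Zs)
qed

section \<open>Supports measured by the excess over the order\<close>

text \<open>Support conditions are graded by the excess of the total degree over a lower bound \<open>s\<close>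
  of the order.\<close>
definition sup3 :: "nat \<Rightarrow> ser3 \<Rightarrow> (nat \<Rightarrow> nat \<Rightarrow> nat \<Rightarrow> bool) \<Rightarrow> bool" where
  "sup3 s A X \<longleftrightarrow> (\<forall>a b c. A a b c \<noteq> 0 \<longrightarrow> s \<le> a + b + c \<and> X a b (a + b + c - s))"

lemma sup3I:
  assumes "\<And>a b c. A a b c \<noteq> 0 \<Longrightarrow> s \<le> a + b + c \<and> X a b (a + b + c - s)"
  shows "sup3 s A X"
  using assms unfolding sup3_def by blast

lemma sup3D:
  assumes "sup3 s A X" "A a b c \<noteq> 0"
  obtains e where "a + b + c = s + e" "X a b e"
  using assms unfolding sup3_def by (metis le_add_diff_inverse)

lemma sup3_order: "sup3 s A X \<Longrightarrow> A a b c \<noteq> 0 \<Longrightarrow> s \<le> a + b + c"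
  unfolding sup3_def by blast

lemma sup3_mono:
  assumes "sup3 s A X" "\<And>a b e. X a b e \<Longrightarrow> Y a b e"
  shows "sup3 s A Y"
  using assms unfolding sup3_def by blast

lemma sup3_cnj3: "sup3 s A X \<Longrightarrow> sup3 s (cnj3 A) (\<lambda>a b e. X b a e)"
  unfolding sup3_def cnj3_def by (metis add.commute complex_cnj_zero_iff)

lemma sup3_mul3D:
  assumes "sup3 s A X" "sup3 t B Y" "mul3 A B a b c \<noteq> 0"
  obtains a1 b1 e1 a2 b2 e2 where "X a1 b1 e1" "Y a2 b2 e2" "a = a1 + a2" "b = b1 + b2"
    "a + b + c = s + t + e1 + e2"
proof -
  from assms(3) obtain i j k where *: "i \<le> a" "j \<le> b" "k \<le> c" "A i j k \<noteq> 0" "B (a - i) (b - j) (c - k) \<noteq> 0"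
    by (rule mul3_nonzeroE)
  obtain e1 where e1: "i + j + k = s + e1" "X i j e1" using sup3D[OF assms(1), OF *(4)] by blast
  obtain e2 where e2: "a - i + (b - j) + (c - k) = t + e2" "Y (a - i) (b - j) e2"
    using sup3D[OF assms(2), OF *(5)] by blast
  show thesis by (rule that[OF e1(2) e2(2)]) (use * e1 e2 in linarith)+
qed

text \<open>Orders and excesses both add under multiplication, so additive compatibility of the
  three conditions suffices.\<close>

lemma sup3_mul3:
  assumes "sup3 s A X" "sup3 t B Y"
    and "\<And>a1 b1 e1 a2 b2 e2. X a1 b1 e1 \<Longrightarrow> Y a2 b2 e2 \<Longrightarrow> Z (a1 + a2) (b1 + b2) (e1 + e2)"
  shows "sup3 (s + t) (mul3 A B) Z"
proof (rule sup3I)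
  fix a b c assume "mul3 A B a b c \<noteq> 0"
  from sup3_mul3D[OF assms(1,2) this] obtain a1 b1 e1 a2 b2 e2 where
    *: "X a1 b1 e1" "Y a2 b2 e2" "a = a1 + a2" "b = b1 + b2" "a + b + c = s + t + e1 + e2" by blast
  then have "a + b + c - (s + t) = e1 + e2" by linarith
  then show "s + t \<le> a + b + c \<and> Z a b (a + b + c - (s + t))"
    using assms(3)[OF *(1,2)] * by simp
qed

text \<open>Each factor raises the order bound by 1, so \<open>pow3 A k\<close> is measured by its
  excess over \<open>k\<close>; \<open>Y\<close> may depend on \<open>k\<close> to count the
  variables supplied by linear parts.\<close>

lemma sup3_pow3:
  assumes "sup3 1 A X" "Y 0 0 0 0"
    and "\<And>k a1 b1 e1 a2 b2 e2. X a1 b1 e1 \<Longrightarrow> Y k a2 b2 e2 \<Longrightarrow> Y (Suc k) (a1 + a2) (b1 + b2) (e1 + e2)"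
  shows "sup3 k (pow3 A k) (Y k)"
proof (induction k)
  case 0
  show ?case using assms(2) by (auto simp: sup3_def one3_def split: if_splits)
next
  case (Suc k)
  show ?case using sup3_mul3[OF assms(1) Suc.IH, of "Y (Suc k)"] assms(3) by simp
qed

lemma comp3_single:
  assumes "i + j + k \<le> a + b + c"
    and "\<And>i' j' k'. i' + j' + k' \<le> a + b + c \<Longrightarrow> r i' j' k' \<noteq> 0 \<Longrightarrow>
      mul3 (pow3 P i') (mul3 (pow3 Q j') (pow3 R k')) a b c \<noteq> 0 \<Longrightarrow> i' = i \<and> j' = j \<and> k' = k"
  shows "comp3 r P Q R a b c = r i j k * mul3 (pow3 P i) (mul3 (pow3 Q j) (pow3 R k)) a b c"
proof -
  have "comp3 r P Q R a b c = (\<Sum>x\<in>{(i, j, k)}. case x of (i, j, k) \<Rightarrow>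
      r i j k * mul3 (pow3 P i) (mul3 (pow3 Q j) (pow3 R k)) a b c)"
    unfolding comp3_def
  proof (rule sum.mono_neutral_right[OF finite_triples_le])
    show "{(i, j, k)} \<subseteq> {(i, j, k). i + j + k \<le> a + b + c}" using assms(1) by simp
    show "\<forall>x\<in>{(i, j, k). i + j + k \<le> a + b + c} - {(i, j, k)}.
        (case x of (i, j, k) \<Rightarrow> r i j k * mul3 (pow3 P i) (mul3 (pow3 Q j) (pow3 R k)) a b c) = 0"
    proof (intro ballI, elim DiffE CollectE case_prodE, hypsubst, unfold case_prod_conv)
      fix i' j' k' assume "i' + j' + k' \<le> a + b + c" "(i', j', k') \<notin> {(i, j, k)}"
      then have "r i' j' k' = 0 \<or> mul3 (pow3 P i') (mul3 (pow3 Q j') (pow3 R k')) a b c = 0"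
        using assms(2)[of i' j' k'] by blast
      then show "r i' j' k' * mul3 (pow3 P i') (mul3 (pow3 Q j') (pow3 R k')) a b c = 0" by simp
    qed
  qed
  then show ?thesis by simp
qed

lemma comp3_nonzeroE:
  assumes "comp3 r P Q R a b c \<noteq> 0"
  obtains i j k where "i + j + k \<le> a + b + c" "r i j k \<noteq> 0"
    "mul3 (pow3 P i) (mul3 (pow3 Q j) (pow3 R k)) a b c \<noteq> 0"
proof -
  from assms obtain x where "x \<in> {(i, j, k). i + j + k \<le> a + b + c}"
    "(case x of (i, j, k) \<Rightarrow> r i j k * mul3 (pow3 P i) (mul3 (pow3 Q j) (pow3 R k)) a b c) \<noteq> 0"
    unfolding comp3_def by (meson sum.not_neutral_contains_not_neutral)
  then show thesis using that by auto
qed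


text \<open>Splits a monomial of a triple product, the shape of every term of
  \<open>comp3\<close>.\<close>

lemma sup3_mul3_mul3D:
  assumes "sup3 s A X" "sup3 t B Y" "sup3 u C Z" "mul3 A (mul3 B C) a b c \<noteq> 0"
  obtains a1 b1 e1 a2 b2 e2 a3 b3 e3 where "X a1 b1 e1" "Y a2 b2 e2" "Z a3 b3 e3"
    "a = a1 + a2 + a3" "b = b1 + b2 + b3" "a + b + c = s + t + u + e1 + e2 + e3"
proof -
  have "sup3 (t + u) (mul3 B C) (\<lambda>a b e. \<exists>a2 b2 e2 a3 b3 e3. Y a2 b2 e2 \<and> Z a3 b3 e3 \<and>
      a = a2 + a3 \<and> b = b2 + b3 \<and> e = e2 + e3)"
    by (rule sup3_mul3[OF assms(2,3)]) blast
  then obtain a1 b1 e1 a' b' e' where 1: "X a1 b1 e1" and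
      2: "\<exists>a2 b2 e2 a3 b3 e3. Y a2 b2 e2 \<and> Z a3 b3 e3 \<and> a' = a2 + a3 \<and> b' = b2 + b3 \<and> e' = e2 + e3"
      and 3: "a = a1 + a'" "b = b1 + b'" "a + b + c = s + (t + u) + e1 + e'"
    by (rule sup3_mul3D[OF assms(1) _ assms(4)])
  from 2 obtain a2 b2 e2 a3 b3 e3 where 4: "Y a2 b2 e2" "Z a3 b3 e3" "a' = a2 + a3" "b' = b2 + b3"
    "e' = e2 + e3" by blast
  show thesis by (rule that[OF 1 4(1,2)]) (use 3 4 in simp_all)
qed

text \<open>Setting zbar = 0 is multiplicative; this is applied to \<open>W\<close>, which restricts
  to u.\<close>

lemma pow3_b0:
  assumes "\<And>a c. A a 0 c = (if a = 0 \<and> c = 1 then 1 else 0)"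
  shows "pow3 A j a 0 c = (if a = 0 \<and> c = j then 1 else 0)"
proof (induction j arbitrary: a c)
  case 0
  show ?case by (simp add: one3_def)
next
  case (Suc j)
  show ?case
  proof (cases "a = 0 \<and> c = Suc j")
    case True
    have "mul3 A (pow3 A j) a 0 c = A 0 0 1 * pow3 A j (a - 0) (0 - 0) (c - 1)"
      by (rule mul3_single) (use True in \<open>auto simp: assms Suc split: if_splits\<close>)
    then show ?thesis using True by (simp add: assms Suc)
  next
    case False
    have "mul3 A (pow3 A j) a 0 c = 0"
      by (rule ccontr, erule mul3_nonzeroE) (use False in \<open>auto simp: assms Suc split: if_splits\<close>)
    then show ?thesis using False by simp
  qed
qed

lemma pow3_a0:
  assumes "\<And>b c. A 0 b c = (if b = 0 \<and> c = 1 then 1 else 0)"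
  shows "pow3 A j 0 b c = (if b = 0 \<and> c = j then 1 else 0)"
proof (induction j arbitrary: b c)
  case 0
  show ?case by (simp add: one3_def)
next
  case (Suc j)
  show ?case
  proof (cases "b = 0 \<and> c = Suc j")
    case True
    have "mul3 A (pow3 A j) 0 b c = A 0 0 1 * pow3 A j (0 - 0) (b - 0) (c - 1)"
      by (rule mul3_single) (use True in \<open>auto simp: assms Suc split: if_splits\<close>)
    then show ?thesis using True by (simp add: assms Suc)
  next
    case False
    have "mul3 A (pow3 A j) 0 b c = 0"
      by (rule ccontr, erule mul3_nonzeroE) (use False in \<open>auto simp: assms Suc split: if_splits\<close>)
    then show ?thesis using False by simp
  qed
qed

lemma mul3_one3_left: "mul3 one3 A = A"
  using mul3_pow3_Zs[of 0 A] by (intro ext) simp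

section \<open>The basic identity and its consequences in low degree\<close>

locale nf_map =
  fixes d m :: nat and r r' :: ser3 and f g :: ser2
  assumes d_eq: "d = m + 1" and m_pos: "1 \<le> m"
    and r_supp: "\<And>a b c. r a b c \<noteq> 0 \<Longrightarrow> a = 1 \<and> b = 1 \<and> c = m \<or> 2 \<le> a \<and> 2 \<le> b \<and> m \<le> c"
    and r'_supp: "\<And>a b c. r' a b c \<noteq> 0 \<Longrightarrow> a = 1 \<and> b = 1 \<and> c = m \<or> 2 \<le> a \<and> 2 \<le> b \<and> m \<le> c"
    and real_r: "real3 r" and r'_11: "r' 1 1 m \<noteq> 0" and maps: "maps_hyp f g r r'"
begin

text \<open>On the hypersurface w = u + i r; \<open>F\<close>, \<open>G\<close> and \<open>H\<close>
  are f, g and Re g restricted to it.\<close>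

definition W where "W = (\<lambda>a b c. Us a b c + \<i> * r a b c)"
definition F where "F = comp2 f Zs W"
definition G where "G = comp2 g Zs W"
definition H where "H = (\<lambda>a b c. (G a b c + cnj3 G a b c) / 2)"

lemma f_00: "f 0 0 = 0" and g_00: "g 0 0 = 0" and jacobian: "f 1 0 * g 0 1 - f 0 1 * g 1 0 \<noteq> 0"
  and key: "(G a b c - cnj3 G a b c) / (2 * \<i>) = comp3 r' F (cnj3 F) H a b c"
proof -
  have *: "f 0 0 = 0 \<and> g 0 0 = 0 \<and> f 1 0 * g 0 1 - f 0 1 * g 1 0 \<noteq> 0 \<and>
      (\<lambda>a b c. (G a b c - cnj3 G a b c) / (2 * \<i>)) = comp3 r' F (cnj3 F) H"
    using maps unfolding maps_hyp_def Let_def W_def F_def G_def H_def by blast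
  then show "f 0 0 = 0" "g 0 0 = 0" "f 1 0 * g 0 1 - f 0 1 * g 1 0 \<noteq> 0" by blast+
  from * have "(\<lambda>a b c. (G a b c - cnj3 G a b c) / (2 * \<i>)) = comp3 r' F (cnj3 F) H" by blast
  from fun_cong[OF fun_cong[OF fun_cong[OF this]]]
  show "(G a b c - cnj3 G a b c) / (2 * \<i>) = comp3 r' F (cnj3 F) H a b c" .
qed

text \<open>Every monomial of \<open>r\<close> contains both z and zbar, so \<open>r\<close> drops
  out at zbar = 0.\<close>

lemma W_b0: "W a 0 c = (if a = 0 \<and> c = 1 then 1 else 0)"
  using r_supp[of a 0 c] by (auto simp: W_def Us_def)

lemma W_a0: "W 0 b c = (if b = 0 \<and> c = 1 then 1 else 0)"
  using r_supp[of 0 b c] by (auto simp: W_def Us_def)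

lemma comp2_W_b0: "comp2 p Zs W a 0 c = p a c"
proof -
  have "comp2 p Zs W a 0 c = p a c * pow3 W c (a - a) 0 c"
    by (rule comp2_Zs_single) (auto simp: pow3_b0[of W, OF W_b0] split: if_splits)
  then show ?thesis by (simp add: pow3_b0[of W, OF W_b0])
qed

lemma comp2_W_a0: "comp2 p Zs W 0 b c = (if b = 0 then p 0 c else 0)"
proof (cases "b = 0")
  case False
  have "comp2 p Zs W 0 b c = 0"
    by (rule ccontr, erule comp2_Zs_nonzeroE)
      (use False in \<open>auto simp: pow3_a0[of W, OF W_a0] split: if_splits\<close>)
  then show ?thesis using False by simp
qed (simp add: comp2_W_b0)

lemma F_b0: "F a 0 c = f a c" and F_a0: "F 0 b c = (if b = 0 then f 0 c else 0)"
  and G_b0: "G a 0 c = g a c" and G_a0: "G 0 b c = (if b = 0 then g 0 c else 0)"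
  unfolding F_def G_def by (simp_all add: comp2_W_b0 comp2_W_a0)

lemma r'_deg: "r' i j k \<noteq> 0 \<Longrightarrow> d + 1 \<le> i + j + k"
  using r'_supp[of i j k] d_eq by linarith

text \<open>For \<open>e = 0\<close> the condition describes the linear part; zbar is absent there
  because F(0, zbar, u) = f(0, u).\<close>

lemma order_F: "sup3 1 F (\<lambda>a b e. 1 \<le> e \<or> a \<le> 1 \<and> b = 0)"
proof (rule sup3I)
  fix a b c assume nz: "F a b c \<noteq> 0"
  have "F 0 0 0 = 0" "F 0 1 0 = 0" by (simp_all add: F_b0 F_a0 f_00)
  then have "\<not> (a = 0 \<and> b = 0 \<and> c = 0)" "\<not> (a = 0 \<and> b = 1 \<and> c = 0)"
    using nz by blast+
  then show "1 \<le> a + b + c \<and> (1 \<le> a + b + c - 1 \<or> a \<le> 1 \<and> b = 0)" by presburger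
qed

lemma order_H: "sup3 1 H (\<lambda>a b e. True)"
proof (rule sup3I)
  fix a b c assume nz: "H a b c \<noteq> 0"
  have "H 0 0 0 = 0" by (simp add: H_def cnj3_def G_b0 g_00)
  then show "1 \<le> a + b + c \<and> True" using nz by (cases "a + b + c = 0") auto
qed

lemma order_prod:
  assumes "mul3 (pow3 F i) (mul3 (pow3 (cnj3 F) j) (pow3 H k)) a b c \<noteq> 0"
  shows "i + j + k \<le> a + b + c"
proof -
  have F: "sup3 1 F (\<lambda>a b e. True)" by (rule sup3_mono[OF order_F]) simp
  have C: "sup3 1 (cnj3 F) (\<lambda>a b e. True)" by (rule sup3_cnj3[OF F])
  show ?thesis
    by (rule sup3_mul3_mul3D[OF sup3_pow3[OF F, of "\<lambda>_ _ _ _. True"]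
        sup3_pow3[OF C, of "\<lambda>_ _ _ _. True"] sup3_pow3[OF order_H, of "\<lambda>_ _ _ _. True"] assms])
      simp_all
qed

text \<open>The lowest monomial of \<open>r'\<close> is z zbar u^m, of degree d + 1, and
  \<open>F\<close>, its conjugate and \<open>H\<close> have order at least 1.\<close>

lemma rhs_low: "a + b + c \<le> d \<Longrightarrow> comp3 r' F (cnj3 F) H a b c = 0"
  by (rule ccontr, erule comp3_nonzeroE) (drule r'_deg, drule order_prod, linarith)

text \<open>At z^i u^j the conjugate of \<open>G\<close> contributes nothing, because G(0, zbar, u)
  depends on u only; so the left side is a nonzero multiple of \<open>g i j\<close>.\<close>

lemma g_low: "1 \<le> i \<Longrightarrow> i + j \<le> d \<Longrightarrow> g i j = 0"
  using key[of i 0 j] rhs_low[of i 0 j] by (simp add: cnj3_def G_b0 G_a0)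

lemma d_ge2: "2 \<le> d" using d_eq m_pos by simp

lemma g_01_real: "cnj (g 0 1) = g 0 1"
  using key[of 0 0 1] rhs_low[of 0 0 1] d_ge2 by (simp add: cnj3_def G_b0)

text \<open>Since \<open>g 1 0 = 0\<close>, the Jacobian reduces to
  \<open>f 1 0 * g 0 1\<close>.\<close>

lemma f_10_nz: "f 1 0 \<noteq> 0" and g_01_nz: "g 0 1 \<noteq> 0"
  using jacobian g_low[of 1 0] d_ge2 by auto

lemma order_H': "sup3 1 H (\<lambda>a b e. 1 \<le> e \<or> a = 0 \<and> b = 0)"
proof (rule sup3I)
  fix a b c assume nz: "H a b c \<noteq> 0"
  have 1: "1 \<le> a + b + c" using order_H nz unfolding sup3_def by blast
  have "H 1 0 0 = 0" "H 0 1 0 = 0" using g_low[of 1 0] d_ge2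
    by (simp_all add: H_def cnj3_def G_b0 G_a0)
  moreover have "a + b + c = 1 \<Longrightarrow> a = 0 \<and> b = 0 \<or> a = 1 \<and> b = 0 \<and> c = 0 \<or> a = 0 \<and> b = 1 \<and> c = 0"
    by linarith
  ultimately have "a + b + c = 1 \<Longrightarrow> a = 0 \<and> b = 0" using nz by blast
  then show "1 \<le> a + b + c \<and> (1 \<le> a + b + c - 1 \<or> a = 0 \<and> b = 0)" using 1 by linarith
qed

lemma lead_F: "sup3 i (pow3 F i) (\<lambda>a b e. 1 \<le> e \<or> a \<le> i \<and> b = 0)"
  by (rule sup3_pow3[OF order_F, of "\<lambda>i a b e. 1 \<le> e \<or> a \<le> i \<and> b = 0"]) auto

lemma lead_cnj3_F: "sup3 i (pow3 (cnj3 F) i) (\<lambda>a b e. 1 \<le> e \<or> b \<le> i \<and> a = 0)"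
  by (rule sup3_pow3[OF sup3_cnj3[OF order_F], of "\<lambda>i a b e. 1 \<le> e \<or> b \<le> i \<and> a = 0"]) auto

lemma lead_H: "sup3 i (pow3 H i) (\<lambda>a b e. 1 \<le> e \<or> a = 0 \<and> b = 0)"
  by (rule sup3_pow3[OF order_H', of "\<lambda>i a b e. 1 \<le> e \<or> a = 0 \<and> b = 0"]) auto

text \<open>In the lowest possible degree only linear parts contribute: that of \<open>F\<close>
  involves z and u, that of its conjugate zbar and u, that of \<open>H\<close> only u.\<close>

lemma lead_prod:
  assumes "mul3 (pow3 F i) (mul3 (pow3 (cnj3 F) j) (pow3 H k)) a b c \<noteq> 0"
    and "a + b + c \<le> i + j + k"
  shows "a \<le> i \<and> b \<le> j"
proof -
  obtain a1 b1 e1 a2 b2 e2 a3 b3 e3 where *: "1 \<le> e1 \<or> a1 \<le> i \<and> b1 = 0" "1 \<le> e2 \<or> b2 \<le> j \<and> a2 = 0"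
    "1 \<le> e3 \<or> a3 = 0 \<and> b3 = 0" "a = a1 + a2 + a3" "b = b1 + b2 + b3"
    "a + b + c = i + j + k + e1 + e2 + e3"
    by (rule sup3_mul3_mul3D[OF lead_F lead_cnj3_F lead_H assms(1)])
  then have "e1 = 0" "e2 = 0" "e3 = 0" using assms(2) by linarith+
  then show ?thesis using * by simp
qed

text \<open>In degree d + 1 the right side comes from z zbar u^m alone, and there the linear part of
  \<open>F\<close> supplies at most one z.\<close>

lemma g_d_Suc:
  assumes ij: "2 \<le> i" "i + j = d + 1"
  shows "g i j = 0"
proof -
  have "comp3 r' F (cnj3 F) H i 0 j = 0"
  proof (rule ccontr)
    assume "comp3 r' F (cnj3 F) H i 0 j \<noteq> 0"
    then obtain i' j' k' where *: "i' + j' + k' \<le> i + 0 + j" "r' i' j' k' \<noteq> 0"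
      "mul3 (pow3 F i') (mul3 (pow3 (cnj3 F) j') (pow3 H k')) i 0 j \<noteq> 0"
      by (rule comp3_nonzeroE)
    have w: "i + 0 + j \<le> i' + j' + k'" using r'_deg[OF *(2)] ij(2) by linarith
    have "i' = 1" using r'_supp[OF *(2)] *(1) ij(2) d_eq by linarith
    then show False using lead_prod[OF *(3) w] ij(1) by linarith
  qed
  then show "g i j = 0" using key[of i 0 j] ij(1) by (simp add: cnj3_def G_b0 G_a0)
qed

lemma pow3_F_top: "pow3 F i i 0 0 = f 1 0 ^ i"
proof (induction i)
  case (Suc i)
  have "mul3 F (pow3 F i) (Suc i) 0 0 = F 1 0 0 * pow3 F i (Suc i - 1) (0 - 0) (0 - 0)"
  proof (rule mul3_single)
    fix i' j' k' assume *: "i' \<le> Suc i" "j' \<le> 0" "k' \<le> 0" "F i' j' k' \<noteq> 0"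
      "pow3 F i (Suc i - i') (0 - j') (0 - k') \<noteq> 0"
    have "1 \<le> i' + j' + k'" "i \<le> (Suc i - i') + (0 - j') + (0 - k')"
      by (rule sup3_order[OF order_F, OF *(4)], rule sup3_order[OF lead_F, OF *(5)])
    then show "i' = 1 \<and> j' = 0 \<and> k' = 0" using *(1-3) by linarith
  qed simp_all
  then show ?case using Suc by (simp add: F_b0)
qed (simp add: one3_def)

lemma pow3_cnj3_F_top: "pow3 (cnj3 F) i 0 i 0 = cnj (f 1 0) ^ i"
proof (induction i)
  case (Suc i)
  have "mul3 (cnj3 F) (pow3 (cnj3 F) i) 0 (Suc i) 0 =
      cnj3 F 0 1 0 * pow3 (cnj3 F) i (0 - 0) (Suc i - 1) (0 - 0)"
  proof (rule mul3_single)
    fix i' j' k' assume *: "i' \<le> 0" "j' \<le> Suc i" "k' \<le> 0" "cnj3 F i' j' k' \<noteq> 0"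
      "pow3 (cnj3 F) i (0 - i') (Suc i - j') (0 - k') \<noteq> 0"
    have "1 \<le> i' + j' + k'" "i \<le> (0 - i') + (Suc i - j') + (0 - k')"
      by (rule sup3_order[OF sup3_cnj3[OF order_F], OF *(4)], rule sup3_order[OF lead_cnj3_F, OF *(5)])
    then show "i' = 0 \<and> j' = 1 \<and> k' = 0" using *(1-3) by linarith
  qed simp_all
  then show ?case using Suc by (simp add: F_b0 cnj3_def)
qed (simp add: one3_def)

lemma pow3_H_top: "pow3 H i 0 0 i = g 0 1 ^ i"
proof (induction i)
  case (Suc i)
  have "mul3 H (pow3 H i) 0 0 (Suc i) = H 0 0 1 * pow3 H i (0 - 0) (0 - 0) (Suc i - 1)"
  proof (rule mul3_single)
    fix i' j' k' assume *: "i' \<le> 0" "j' \<le> 0" "k' \<le> Suc i" "H i' j' k' \<noteq> 0"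
      "pow3 H i (0 - i') (0 - j') (Suc i - k') \<noteq> 0"
    have "1 \<le> i' + j' + k'" "i \<le> (0 - i') + (0 - j') + (Suc i - k')"
      by (rule sup3_order[OF order_H, OF *(4)], rule sup3_order[OF lead_H, OF *(5)])
    then show "i' = 0 \<and> j' = 0 \<and> k' = 1" using *(1-3) by linarith
  qed simp_all
  moreover have "H 0 0 1 = g 0 1" using g_01_real by (simp add: H_def cnj3_def G_b0)
  ultimately show ?case using Suc by simp
qed (simp add: one3_def)

text \<open>Every factor must contribute its pure linear term: z from \<open>F\<close>, zbar from
  its conjugate, u from \<open>H\<close>.\<close>

lemma prod_top:
  "mul3 (pow3 F i) (mul3 (pow3 (cnj3 F) j) (pow3 H k)) i j k = f 1 0 ^ i * (cnj (f 1 0) ^ j * g 0 1 ^ k)"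
proof -
  have 1: "mul3 (pow3 (cnj3 F) j) (pow3 H k) 0 j k =
      pow3 (cnj3 F) j 0 j 0 * pow3 H k (0 - 0) (j - j) (k - 0)"
  proof (rule mul3_single)
    fix a b c assume *: "a \<le> 0" "b \<le> j" "c \<le> k" "pow3 (cnj3 F) j a b c \<noteq> 0"
      "pow3 H k (0 - a) (j - b) (k - c) \<noteq> 0"
    obtain e1 where 1: "a + b + c = j + e1" "1 \<le> e1 \<or> b \<le> j \<and> a = 0"
      by (rule sup3D[OF lead_cnj3_F, OF *(4)])
    obtain e2 where 2: "(0 - a) + (j - b) + (k - c) = k + e2" "1 \<le> e2 \<or> 0 - a = 0 \<and> j - b = 0"
      by (rule sup3D[OF lead_H, OF *(5)])
    have "e1 = 0" "e2 = 0" using 1(1) 2(1) *(1-3) by linarith+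
    then show "a = 0 \<and> b = j \<and> c = 0" using 1 2 *(1-3) by auto
  qed simp_all
  have "mul3 (pow3 F i) (mul3 (pow3 (cnj3 F) j) (pow3 H k)) i j k =
      pow3 F i i 0 0 * mul3 (pow3 (cnj3 F) j) (pow3 H k) (i - i) (j - 0) (k - 0)"
  proof (rule mul3_single)
    fix a b c assume *: "a \<le> i" "b \<le> j" "c \<le> k" "pow3 F i a b c \<noteq> 0"
      "mul3 (pow3 (cnj3 F) j) (pow3 H k) (i - a) (j - b) (k - c) \<noteq> 0"
    obtain e1 where 1: "a + b + c = i + e1" "1 \<le> e1 \<or> a \<le> i \<and> b = 0"
      by (rule sup3D[OF lead_F, OF *(4)])
    obtain a2 b2 e2 a3 b3 e3 where 2: "1 \<le> e2 \<or> b2 \<le> j \<and> a2 = 0" "1 \<le> e3 \<or> a3 = 0 \<and> b3 = 0"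
      "i - a = a2 + a3" "j - b = b2 + b3" "(i - a) + (j - b) + (k - c) = j + k + e2 + e3"
      by (rule sup3_mul3D[OF lead_cnj3_F lead_H *(5)])
    have "e1 = 0" "e2 = 0" "e3 = 0" using 1(1) 2(5) *(1-3) by linarith+
    then show "a = i \<and> b = 0 \<and> c = 0" using 1 2(1-4) *(1-3) by auto
  qed simp_all
  then show ?thesis using 1 by (simp add: pow3_F_top pow3_cnj3_F_top pow3_H_top)
qed

lemma prod_top_nz: "mul3 (pow3 F i) (mul3 (pow3 (cnj3 F) j) (pow3 H k)) i j k \<noteq> 0"
  using f_10_nz g_01_nz by (simp add: prod_top)

text \<open>Apart from powers of w, z w^d is the only monomial of degree at most d + 1 that
  \<open>g\<close> may contain; this exception recurs in the bounds below.\<close>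

lemma g_shape:
  assumes "g i j \<noteq> 0"
  shows "i = 0 \<and> 1 \<le> j \<or> i = 1 \<and> d \<le> j \<or> 1 \<le> i \<and> d + 2 \<le> i + j"
proof -
  have "\<not> (i = 0 \<and> j = 0)" "\<not> (1 \<le> i \<and> i + j \<le> d)" "\<not> (2 \<le> i \<and> i + j = d + 1)"
    using assms g_00 g_low[of i j] g_d_Suc[of i j] by blast+
  then show ?thesis by linarith
qed

end

section \<open>Bad monomials and the degree of a first violation\<close>

text \<open>The order bounds of Fuchsian type, rewritten with \<open>d = m + 1\<close> and the total degree
  \<open>w = a + b + c\<close> of the monomial \<open>z^a zbar^b u^c\<close> of the defining series (so \<open>c\<close> includes the
  factor \<open>u^m\<close>): the bad monomials are the excluded ones.\<close>
definition bad :: "nat \<Rightarrow> nat \<Rightarrow> nat \<Rightarrow> nat \<Rightarrow> bool" where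
  "bad d a b w \<longleftrightarrow> 2 \<le> a \<and> 2 \<le> b \<and>
     (a + b = 4 \<and> w < 2 * d + 1 \<or> a + b = 5 \<and> w < 3 * d \<or>
      6 \<le> a + b \<and> (a = 2 \<or> b = 2 \<or> a = 3 \<and> b = 3) \<and> w < 3 * d + 1 \<or>
      7 \<le> a + b \<and> 3 \<le> a \<and> 3 \<le> b \<and> w < 3 * d + 2)"

lemma not_badE:
  assumes "2 \<le> a" "2 \<le> b" "\<not> bad d a b w"
  obtains "a = 2" "b = 2" "2 * d + 1 \<le> w" | "a + b = 5" "3 * d \<le> w"
    | "6 \<le> a + b" "a = 2 \<or> b = 2 \<or> a = 3 \<and> b = 3" "3 * d + 1 \<le> w"
    | "7 \<le> a + b" "3 \<le> a" "3 \<le> b" "3 * d + 2 \<le> w"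
proof -
  consider "a = 2 \<and> b = 2" | "a + b = 5" | "6 \<le> a + b" "a = 2 \<or> b = 2 \<or> a = 3 \<and> b = 3"
    | "7 \<le> a + b" "3 \<le> a" "3 \<le> b" "\<not> (a = 3 \<and> b = 3)"
    using assms(1,2) by linarith
  then show thesis using assms that unfolding bad_def by cases auto
qed

lemma bad_commute: "bad d a b w = bad d b a w"
  unfolding bad_def by (auto simp: add.commute)

text \<open>Both series are good below degree \<open>n\<close>, where a first violation is expected.
  A monomial with a, b >= 2 and c >= m has degree at least m + 4 = d + 3, and all thresholds in
  \<open>bad\<close> are at most 3d + 2; hence the range of \<open>n\<close>.\<close>

locale nf_map_good = nf_map +
  fixes n :: nat
  assumes n_ge: "d + 3 \<le> n" and n_le: "n \<le> 3 * d + 1"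
    and r_good: "\<And>a b c. r a b c \<noteq> 0 \<Longrightarrow> a + b + c < n \<Longrightarrow> \<not> bad d a b (a + b + c)"
    and r'_good: "\<And>a b c. r' a b c \<noteq> 0 \<Longrightarrow> a + b + c < n \<Longrightarrow> \<not> bad d a b (a + b + c)"
begin

text \<open>\<open>RW\<close>, and \<open>XH\<close> below, are chosen closed under addition, so that they bound the supports of
  all powers of \<open>W\<close> and \<open>H\<close>; their last clause absorbs the terms of \<open>r\<close> of degree at least \<open>n\<close>,
  about which nothing is known.\<close>
definition RW :: "nat \<Rightarrow> nat \<Rightarrow> nat \<Rightarrow> bool" where
  "RW a b e \<longleftrightarrow> a = 0 \<and> b = 0 \<or> a = 1 \<and> b = 1 \<and> d \<le> e \<or> a = 2 \<and> b = 2 \<and> 2 * d \<le> e \<or>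
     2 \<le> a \<and> 2 \<le> b \<and> a + b = 5 \<and> 3 * d \<le> e + 1 \<or> n \<le> e + 1"

text \<open>Two (1,1) clauses add up to the (2,2) clause. Any other sum without a (0,0) clause has
  excess at least 3d or inherits the last clause; as n <= 3d + 1, it falls under the last clause
  either way.\<close>

lemma RW_add: "RW a1 b1 e1 \<Longrightarrow> RW a2 b2 e2 \<Longrightarrow> RW (a1 + a2) (b1 + b2) (e1 + e2)"
  using n_le d_ge2 unfolding RW_def by (elim disjE; simp)

lemma sup_W: "sup3 1 W RW"
proof (rule sup3I)
  fix a b c assume "W a b c \<noteq> 0"
  then consider "a = 0 \<and> b = 0 \<and> c = 1" | "r a b c \<noteq> 0"
    unfolding W_def Us_def by (auto split: if_splits)
  then show "1 \<le> a + b + c \<and> RW a b (a + b + c - 1)"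
  proof cases
    case 2
    then consider "a = 1 \<and> b = 1 \<and> c = m" | "2 \<le> a" "2 \<le> b" "n \<le> a + b + c"
      | "2 \<le> a" "2 \<le> b" "\<not> bad d a b (a + b + c)"
      using r_supp[OF 2] r_good[OF 2] by linarith
    then show ?thesis
    proof cases
      case 3
      \<comment> \<open>Degree 3d + 1 is excess 3d over the order 1, hence at least n - 1: the last
        clause of \<open>RW\<close> applies.\<close>
      then consider "a = 2" "b = 2" "2 * d + 1 \<le> a + b + c" | "a + b = 5" "3 * d \<le> a + b + c"
        | "3 * d + 1 \<le> a + b + c"
        by (rule not_badE) auto
      then show ?thesis using 3 n_le by cases (simp_all add: RW_def)
    qed (unfold RW_def, use d_eq in auto)
  qed (simp add: RW_def)
qed

text \<open>The clause for \<open>j = 0\<close> records W^0 = 1; it later forces j >= 1 when a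
  nonconstant monomial is taken from W^j.\<close>

lemma sup_pow_W: "sup3 j (pow3 W j) (\<lambda>a b e. RW a b e \<and> (j = 0 \<longrightarrow> a = 0 \<and> b = 0 \<and> e = 0))"
  by (rule sup3_pow3[OF sup_W, of "\<lambda>j a b e. RW a b e \<and> (j = 0 \<longrightarrow> a = 0 \<and> b = 0 \<and> e = 0)"])
    (auto simp: RW_add, simp add: RW_def)

lemma pow_W_D:
  assumes "pow3 W j a b c \<noteq> 0"
  obtains e where "a + b + c = j + e" "RW a b e" "j = 0 \<longrightarrow> a = 0 \<and> b = 0 \<and> e = 0"
  by (rule sup3D[OF sup_pow_W, OF assms]) (rule that, auto)

text \<open>To reach zbar-degree 2, W^j needs an excess listed in \<open>RW\<close>; adding the
  degree i + j permitted by \<open>g_shape\<close> leaves the bad range or exceeds n unless (i, j) =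
  (0, 1).\<close>

lemma G_bad:
  assumes "a + b + c = n" "bad d a b n"
  shows "G a b c = g 0 1 * (\<i> * r a b c)"
proof -
  have "G a b c = g 0 1 * pow3 W 1 (a - 0) b c"
    unfolding G_def
  proof (rule comp2_Zs_single)
    fix i j assume *: "i \<le> a" "i + j \<le> a + b + c" "g i j \<noteq> 0" "pow3 W j (a - i) b c \<noteq> 0"
    obtain e where e: "(a - i) + b + c = j + e" "RW (a - i) b e" "j = 0 \<longrightarrow> a - i = 0 \<and> b = 0 \<and> e = 0"
      by (rule pow_W_D[OF *(4)])
    obtain a' where a': "a = i + a'" using *(1) le_Suc_ex by blast
    have "n = i + j + e" "RW a' b e" "j = 0 \<longrightarrow> b = 0" using e a' assms(1) by auto
    moreover have "2 \<le> b" "2 \<le> a" using assms(2) by (simp_all add: bad_def)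
    ultimately consider "a' = 2" "b = 2" "2 * d \<le> e" | "2 \<le> a'" "a' + b = 5" "3 * d \<le> e + 1" | "n \<le> e + 1"
      unfolding RW_def by linarith
    then show "i = 0 \<and> j = 1"
      using g_shape[OF *(3)] assms(2) a' \<open>n = i + j + e\<close> n_le d_ge2 unfolding bad_def
      by cases (elim disjE conjE; linarith)+
  qed (use assms n_ge in auto)
  moreover have "a \<noteq> 0" using assms(2) by (auto simp: bad_def)
  moreover have "pow3 W 1 = W" by (simp add: mul3_one3_right)
  ultimately show ?thesis by (simp add: W_def Us_def del: pow3.simps)
qed

text \<open>The right side of the identity equals Im G; since \<open>r\<close> and
  \<open>g 0 1\<close> are real, the factor i in \<open>G_bad\<close> disappears.\<close>

lemma lhs_bad:
  assumes "a + b + c = n" "bad d a b n"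
  shows "comp3 r' F (cnj3 F) H a b c = g 0 1 * r a b c"
proof -
  have "G b a c = g 0 1 * (\<i> * r b a c)"
    by (rule G_bad) (use assms bad_commute in auto)
  moreover have "r b a c = cnj (r a b c)" using real_r unfolding real3_def by blast
  ultimately show ?thesis
    using G_bad[OF assms] g_01_real by (subst key[symmetric]) (simp add: cnj3_def)
qed

lemma comp2_W_D:
  assumes "comp2 p Zs W a b c \<noteq> 0"
  obtains i j a' e where "p i j \<noteq> 0" "a = i + a'" "a + b + c = i + j + e" "RW a' b e"
    "j = 0 \<longrightarrow> a' = 0 \<and> b = 0 \<and> e = 0"
proof -
  obtain i j where 1: "i \<le> a" "p i j \<noteq> 0" "pow3 W j (a - i) b c \<noteq> 0"
    by (rule comp2_Zs_nonzeroE[OF assms])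
  obtain e where 2: "(a - i) + b + c = j + e" "RW (a - i) b e" "j = 0 \<longrightarrow> a - i = 0 \<and> b = 0 \<and> e = 0"
    by (rule pow_W_D[OF 1(3)])
  show thesis by (rule that[OF 1(2) _ _ 2(2,3)]) (use 1(1) 2(1) in linarith)+
qed

section \<open>Supports of Re g and its powers\<close>

definition XH :: "nat \<Rightarrow> nat \<Rightarrow> nat \<Rightarrow> bool" where
  "XH a b e \<longleftrightarrow> a = 0 \<and> b = 0 \<or> d \<le> e \<and> a \<le> 1 \<and> b \<le> 1 \<or> d + 1 \<le> e \<and> (a = 0 \<or> b = 0) \<or>
     2 * d \<le> e \<and> a \<le> 2 \<and> b \<le> 2 \<or> 2 * d + 1 \<le> e \<or> n \<le> e + 1"

lemma XH_commute: "XH a b e = XH b a e"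
  unfolding XH_def by auto

text \<open>Besides (0,0), each clause has excess at least d with both degrees at most 1, or excess
  at least d + 1. Two such pieces give excess 2d with degrees at most 2, or at least 2d + 1.\<close>

lemma XH_add: "XH a1 b1 e1 \<Longrightarrow> XH a2 b2 e2 \<Longrightarrow> XH (a1 + a2) (b1 + b2) (e1 + e2)"
proof -
  assume X1: "XH a1 b1 e1" and X2: "XH a2 b2 e2"
  have weak: "a = 0 \<and> b = 0 \<or> d \<le> e \<and> a \<le> 1 \<and> b \<le> 1 \<or> d + 1 \<le> e" if "XH a b e" for a b e
    using that n_ge d_ge2 unfolding XH_def by linarith
  have mono: "XH a b (e' + e)" if "XH a b e" for a b e e'
    using that unfolding XH_def by (elim disjE conjE) simp_all
  consider "a1 = 0" "b1 = 0" | "a2 = 0" "b2 = 0" | "2 * d + 1 \<le> e1 + e2"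
    | "2 * d \<le> e1 + e2" "a1 + a2 \<le> 2" "b1 + b2 \<le> 2"
    using weak[OF X1] weak[OF X2] by linarith
  then show ?thesis
  proof cases
    case 1
    then show ?thesis using mono[OF X2, of e1] by simp
  next
    case 2
    then show ?thesis using mono[OF X1, of e2] by (simp add: add.commute)
  qed (simp_all add: XH_def)
qed

text \<open>The excess of a monomial of z^i W^j is i + j - 1 plus its excess in W^j;
  \<open>g_shape\<close> bounds the first part and \<open>RW\<close> the second.\<close>

lemma sup_G: "sup3 1 G XH"
proof (rule sup3I)
  fix a b c assume "G a b c \<noteq> 0"
  then obtain i j a' e where *: "g i j \<noteq> 0" "a = i + a'" "a + b + c = i + j + e" "RW a' b e"
    "j = 0 \<longrightarrow> a' = 0 \<and> b = 0 \<and> e = 0"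
    unfolding G_def by (rule comp2_W_D)
  have ij: "1 \<le> i + j" using g_shape[OF *(1)] by linarith
  then have w: "a + b + c - 1 = i + j + e - 1" using *(3) by simp
  have "XH (i + a') b (i + j + e - 1)"
    using *(4) unfolding RW_def
  proof (elim disjE conjE)
    assume "a' = 0" "b = 0"
    then show ?thesis using g_shape[OF *(1)] unfolding XH_def by auto
  next
    assume "a' = 1" "b = 1" "d \<le> e"
    moreover then have "1 \<le> j" using *(5) by (cases j) auto
    ultimately show ?thesis using g_shape[OF *(1)] unfolding XH_def by auto
  next
    assume "a' = 2" "b = 2" "2 * d \<le> e"
    then show ?thesis using g_shape[OF *(1)] d_ge2 unfolding XH_def by auto
  next
    assume "3 * d \<le> e + 1"
    then show ?thesis using ij d_ge2 unfolding XH_def by auto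
  next
    assume "n \<le> e + 1"
    then show ?thesis using ij unfolding XH_def by auto
  qed
  then show "1 \<le> a + b + c \<and> XH a b (a + b + c - 1)" using w *(2,3) ij by simp
qed

lemma sup_H: "sup3 1 H XH"
proof (rule sup3I)
  fix a b c assume "H a b c \<noteq> 0"
  then have "G a b c \<noteq> 0 \<or> G b a c \<noteq> 0" unfolding H_def cnj3_def by auto
  then show "1 \<le> a + b + c \<and> XH a b (a + b + c - 1)"
    using sup_G XH_commute unfolding sup3_def by (metis add.commute)
qed

lemma sup_pow_H: "sup3 k (pow3 H k) XH"
  by (rule sup3_pow3[OF sup_H, of "\<lambda>_. XH"]) (simp add: XH_def, rule XH_add)

section \<open>Low-degree coefficients of f\<close>

definition f_vanish :: "nat \<Rightarrow> bool" where
  "f_vanish s \<longleftrightarrow> (\<forall>i j. 2 \<le> i \<longrightarrow> i + j \<le> s \<longrightarrow> f i j = 0)"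

text \<open>Support of \<open>F\<close> when \<open>f\<close> is of degree at most 1 in z up to
  degree \<open>s\<close>; the clause \<open>s \<le> e\<close> holds the coefficients still unknown.
  Only excess up to \<open>d\<close> is examined with it, so the last clause is left open.\<close>

definition XF :: "nat \<Rightarrow> nat \<Rightarrow> nat \<Rightarrow> nat \<Rightarrow> bool" where
  "XF s a b e \<longleftrightarrow> a \<le> 1 \<and> b = 0 \<or> s \<le> e \<and> b = 0 \<or> d \<le> e \<and> a = 1 \<and> b = 1 \<or> d + 1 \<le> e"

lemma sup_F:
  assumes "f_vanish s" "1 \<le> s" "s \<le> d"
  shows "sup3 1 F (XF s)"
proof (rule sup3I)
  fix a b c assume "F a b c \<noteq> 0"
  then obtain i j a' e where *: "f i j \<noteq> 0" "a = i + a'" "a + b + c = i + j + e" "RW a' b e"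
    "j = 0 \<longrightarrow> a' = 0 \<and> b = 0 \<and> e = 0"
    unfolding F_def by (rule comp2_W_D)
  have ij: "1 \<le> i + j" using *(1) f_00 by (cases "i = 0 \<and> j = 0") auto
  then have w: "a + b + c - 1 = i + j + e - 1" using *(3) by simp
  have f: "i \<le> 1 \<or> s + 1 \<le> i + j"
  proof (rule ccontr)
    assume "\<not> ?thesis"
    then have "2 \<le> i" "i + j \<le> s" by simp_all
    then show False using *(1) assms(1) unfolding f_vanish_def by blast
  qed
  have "XF s (i + a') b (i + j + e - 1)"
    using *(4) unfolding RW_def
  proof (elim disjE conjE)
    assume "a' = 0" "b = 0"
    then show ?thesis using f unfolding XF_def by auto
  next
    assume "a' = 1" "b = 1" "d \<le> e"
    \<comment> \<open>Excludes the term \<open>f 1 0\<close> times z, which cannot produce zbar;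
      otherwise i = 1 would allow z^2 zbar with excess only d.\<close>
    moreover then have "1 \<le> j" using *(5) by (cases j) auto
    ultimately show ?thesis using f assms unfolding XF_def by (cases "i = 0") auto
  next
    assume "a' = 2" "b = 2" "2 * d \<le> e"
    then show ?thesis using ij d_ge2 unfolding XF_def by auto
  next
    assume "3 * d \<le> e + 1"
    then show ?thesis using ij d_ge2 unfolding XF_def by auto
  next
    assume "n \<le> e + 1"
    then show ?thesis using ij n_ge unfolding XF_def by auto
  qed
  then show "1 \<le> a + b + c \<and> XF s a b (a + b + c - 1)" using w *(2,3) ij by simp
qed

text \<open>In \<open>G\<close>, one zbar costs excess d in W^j, leaving i' = i - 1 and i' + j <= s
  + 1; there \<open>g\<close> vanishes except for z w^d, which \<open>s < d \<or> 3 \<le> i\<close>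
  excludes. The conjugate would need excess n - 1.\<close>

lemma lhs_one:
  assumes "2 \<le> i" "d + 1 + s < n" "s \<le> d" "s < d \<or> 3 \<le> i" "i + 1 + c = d + 1 + s"
  shows "comp3 r' F (cnj3 F) H i 1 c = 0"
proof -
  have "G i 1 c = 0"
  proof (rule ccontr)
    assume "G i 1 c \<noteq> 0"
    then obtain i' j a' e where *: "g i' j \<noteq> 0" "i = i' + a'" "i + 1 + c = i' + j + e" "RW a' 1 e"
      unfolding G_def by (rule comp2_W_D)
    then consider "a' = 1" "d \<le> e" | "n \<le> e + 1" unfolding RW_def by auto
    then show False
      using g_shape[OF *(1)] assms *(2,3) by cases linarith+
  qed
  moreover have "G 1 i c = 0"
  proof (rule ccontr)
    assume "G 1 i c \<noteq> 0"
    then obtain i' j a' e where *: "g i' j \<noteq> 0" "1 = i' + a'" "1 + i + c = i' + j + e" "RW a' i e"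
      unfolding G_def by (rule comp2_W_D)
    then have "n \<le> e + 1" using assms(1) unfolding RW_def by auto
    then show False using g_shape[OF *(1)] assms *(2,3) by linarith
  qed
  ultimately show ?thesis by (subst key[symmetric]) (simp add: cnj3_def)
qed

text \<open>The coefficient of \<open>z^i zbar u^(m+j)\<close> isolates \<open>f i j\<close>: on the right it occurs only in
  \<open>F conj(F) H^m\<close>, multiplied by nonzero linear coefficients.\<close>
lemma f_extract:
  assumes v: "f_vanish s" and s: "1 \<le> s" "s \<le> d" "d + 1 + s < n"
    and i: "2 \<le> i" "s < d \<or> 3 \<le> i" and ij: "i + j = s + 1"
  shows "f i j = 0"
proof -
  have deg: "i + 1 + (m + j) = d + 1 + s" using ij d_eq by simp
  have "comp3 r' F (cnj3 F) H i 1 (m + j) =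
      r' 1 1 m * mul3 (pow3 F 1) (mul3 (pow3 (cnj3 F) 1) (pow3 H m)) i 1 (m + j)"
  proof (rule comp3_single)
    fix i' j' k' assume *: "i' + j' + k' \<le> i + 1 + (m + j)" "r' i' j' k' \<noteq> 0"
      "mul3 (pow3 F i') (mul3 (pow3 (cnj3 F) j') (pow3 H k')) i 1 (m + j) \<noteq> 0"
    have nb: "\<not> bad d i' j' (i' + j' + k')" using r'_good[OF *(2)] *(1) deg s(3) by linarith
    show "i' = 1 \<and> j' = 1 \<and> k' = m"
    proof (rule ccontr)
      assume "\<not> ?thesis"
      then have ge: "2 \<le> i'" "2 \<le> j'" using r'_supp[OF *(2)] by auto
      have w: "i' + j' + k' \<le> d + 1 + s" using *(1) deg by simp
      \<comment> \<open>A good monomial with both exponents at least 2 has degree at least 2d + 1,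
        so only the case (2,2) with s = d fits; being in lowest degree, it yields z-degree at most
        2.\<close>
      have "i' = 2 \<and> d + 1 + s \<le> i' + j' + k' \<and> s = d"
        by (rule not_badE[OF ge nb]) (use w s(2) d_ge2 in linarith)+
      then show False using lead_prod[OF *(3)] deg i(2) by linarith
    qed
  qed (use i ij in linarith)
  moreover have "mul3 (pow3 F 1) (mul3 (pow3 (cnj3 F) 1) (pow3 H m)) i 1 (m + j) =
      F i 0 j * mul3 (pow3 (cnj3 F) 1) (pow3 H m) (i - i) (1 - 0) (m + j - j)"
    unfolding One_nat_def pow3.simps mul3_one3_right
  proof (rule mul3_single)
    fix a b c assume *: "a \<le> i" "b \<le> Suc 0" "c \<le> m + j" "F a b c \<noteq> 0"
      "mul3 (cnj3 F) (pow3 H m) (i - a) (Suc 0 - b) (m + j - c) \<noteq> 0"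
    obtain e1 where 1: "a + b + c = 1 + e1" "XF s a b e1"
      by (rule sup3D[OF sup_F[OF v s(1,2)], OF *(4)])
    obtain a2 b2 e2 a3 b3 e3 where 2: "XF s b2 a2 e2" "XH a3 b3 e3" "i - a = a2 + a3" "Suc 0 - b = b2 + b3"
      "(i - a) + (Suc 0 - b) + (m + j - c) = 1 + m + e2 + e3"
      by (rule sup3_mul3D[OF sup3_cnj3[OF sup_F[OF v s(1,2)]] sup_pow_H *(5)])
    have e: "e1 + e2 + e3 = s" using 1(1) 2(5) *(1-3) deg d_eq by linarith
    have a: "i = a + a2 + a3" using 2(3) *(1) by linarith
    have C: "a2 = 0 \<or> e2 = d \<and> s = d \<and> a2 = 1"
      using 2(1) e s(2) unfolding XF_def by linarith
    have Hc: "a3 = 0 \<or> e3 = d \<and> s = d \<and> a3 \<le> 1"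
      using 2(2) e s n_ge unfolding XH_def by linarith
    \<comment> \<open>If \<open>F\<close> takes less than the whole excess, it supplies at most one
      z, and the other factors together at most one more, and that only for s = d, where i >=
      3.\<close>
    have "e1 = s"
    proof (rule ccontr)
      assume "e1 \<noteq> s"
      then have "a \<le> 1" using 1(2) e s(2) unfolding XF_def by linarith
      then show False using C Hc i a e s(1) by linarith
    qed
    then have "e2 = 0" "e3 = 0" using e by simp_all
    then have "a = i" using C Hc a s(1) by linarith
    moreover then have "b = 0" using 1(2) \<open>e1 = s\<close> s i unfolding XF_def by linarith
    ultimately show "a = i \<and> b = 0 \<and> c = j" using 1(1) \<open>e1 = s\<close> ij by linarith
  qed simp_all
  moreover have "mul3 (pow3 (cnj3 F) 1) (pow3 H m) 0 1 m \<noteq> 0"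
    using prod_top_nz[of 0 1 m] by (simp add: mul3_one3_left)
  ultimately show "f i j = 0"
    using lhs_one[OF i(1) s(3,2) i(2) deg] r'_11 by (simp add: F_b0)
qed

text \<open>The case s = 1 is vacuous because i >= 2; each further degree is supplied by
  \<open>f_extract\<close>.\<close>

lemma f_vanish: "1 \<le> s \<Longrightarrow> s \<le> d \<Longrightarrow> d + s < n \<Longrightarrow> f_vanish s"
proof (induction s rule: nat_induct_at_least)
  case base
  show ?case unfolding f_vanish_def by auto
next
  case (Suc s)
  then have v: "f_vanish s" by simp
  show ?case unfolding f_vanish_def
  proof (intro allI impI)
    fix i j assume "2 \<le> i" "i + j \<le> Suc s"
    then show "f i j = 0"
      using v f_extract[OF v, of i j] Suc unfolding f_vanish_def by (cases "i + j \<le> s") auto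
  qed
qed

section \<open>Good monomials of the target do not produce bad ones\<close>

lemma good_prod_stage1:
  assumes n: "n \<le> 2 * d + 1" and r': "r' i j k \<noteq> 0" and nb: "\<not> bad d i j (i + j + k)"
    and w: "a + b + c = n" "i + j + k \<le> n"
    and nz: "mul3 (pow3 F i) (mul3 (pow3 (cnj3 F) j) (pow3 H k)) a b c \<noteq> 0"
  shows "\<not> bad d a b n"
proof (cases "i = 1 \<and> j = 1 \<and> k = m")
  case True
  \<comment> \<open>The monomial z zbar u^m has degree d + 1, so \<open>s\<close> is the excess left
    for the three factors.\<close>
  define s where "s = n - d - 1"
  have s: "1 \<le> s" "s \<le> d" "n = d + 1 + s" using n n_ge unfolding s_def by linarith+
  have v: "f_vanish s" by (rule f_vanish) (use s in linarith)+
  have "mul3 F (mul3 (cnj3 F) (pow3 H m)) a b c \<noteq> 0"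
    using nz True by (simp add: mul3_one3_right)
  then obtain a1 b1 e1 a2 b2 e2 a3 b3 e3 where *: "XF s a1 b1 e1" "XF s b2 a2 e2" "XH a3 b3 e3"
    "a = a1 + a2 + a3" "b = b1 + b2 + b3" "a + b + c = 1 + 1 + m + e1 + e2 + e3"
    by (rule sup3_mul3_mul3D[OF sup_F[OF v s(1,2)] sup3_cnj3[OF sup_F[OF v s(1,2)]] sup_pow_H])
  have e: "e1 + e2 + e3 = s" using *(6) w s d_eq by linarith
  have F1: "a1 \<le> 1 \<and> b1 = 0 \<or> e1 = s \<and> b1 = 0 \<or> e1 = s \<and> s = d \<and> a1 = 1 \<and> b1 = 1"
    using *(1) e s(2) unfolding XF_def by linarith
  have F2: "b2 \<le> 1 \<and> a2 = 0 \<or> e2 = s \<and> a2 = 0 \<or> e2 = s \<and> s = d \<and> b2 = 1 \<and> a2 = 1"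
    using *(2) e s(2) unfolding XF_def by linarith
  have H3: "a3 = 0 \<and> b3 = 0 \<or> e3 = s \<and> s = d \<and> a3 \<le> 1 \<and> b3 \<le> 1"
    using *(3) e s n_ge unfolding XH_def by linarith
  \<comment> \<open>The type (2,2) arises only for s = d, that is n = 2d + 1, where it is no longer
    bad.\<close>
  have "a \<le> 1 \<or> b \<le> 1 \<or> a \<le> 2 \<and> b \<le> 2 \<and> s = d"
    using F1 F2 H3 e s(1) *(4,5) by linarith
  then show ?thesis using s(3) unfolding bad_def by auto
next
  case False
  then have ge: "2 \<le> i" "2 \<le> j" using r'_supp[OF r'] by auto
  have "i = 2 \<and> j = 2 \<and> i + j + k = n \<and> n = 2 * d + 1"
    by (rule not_badE[OF ge nb]) (use n w d_ge2 in linarith)+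
  moreover then have "a \<le> i \<and> b \<le> j" using lead_prod[OF nz] w by simp
  ultimately show ?thesis unfolding bad_def by auto
qed

text \<open>Sharpens \<open>XF d\<close>: for n >= 2d + 2 the case s = d of \<open>f_extract\<close>
  also removes the terms of degree d + 1 with i >= 3. The total excess now reaches 2d, so the open
  clause starts at 2d + 1.\<close>

definition XF2 :: "nat \<Rightarrow> nat \<Rightarrow> nat \<Rightarrow> bool" where
  "XF2 a b e \<longleftrightarrow> a \<le> 1 \<and> b = 0 \<or> d \<le> e \<and> a + b \<le> 2 \<or> d + 1 \<le> e \<and> b = 0 \<or>
     d + 1 \<le> e \<and> a = 2 \<and> b = 1 \<or> 2 * d \<le> e \<and> (b \<le> 1 \<or> a \<le> 2 \<and> b \<le> 2) \<or> 2 * d + 1 \<le> e"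

lemma sup_F2:
  assumes n2: "2 * d + 2 \<le> n"
  shows "sup3 1 F XF2"
proof (rule sup3I)
  fix a b c assume "F a b c \<noteq> 0"
  then obtain i j a' e where *: "f i j \<noteq> 0" "a = i + a'" "a + b + c = i + j + e" "RW a' b e"
    "j = 0 \<longrightarrow> a' = 0 \<and> b = 0 \<and> e = 0"
    unfolding F_def by (rule comp2_W_D)
  have ij: "1 \<le> i + j" using *(1) f_00 by (cases "i = 0 \<and> j = 0") auto
  then have w: "a + b + c - 1 = i + j + e - 1" using *(3) by simp
  have v: "f_vanish d" by (rule f_vanish) (use n2 d_ge2 in linarith)+
  \<comment> \<open>In degree d + 1 the case i = 2 stays open: z w^d in g and z^2 zbar^2 terms of
    \<open>r'\<close> may interfere there.\<close>
  have f: "i \<le> 1 \<or> i = 2 \<and> d + 1 \<le> i + j \<or> d + 2 \<le> i + j"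
  proof (rule ccontr)
    assume A: "\<not> ?thesis"
    then consider "2 \<le> i" "i + j \<le> d" | "3 \<le> i" "i + j = d + 1" by linarith
    then show False
    proof cases
      case 1
      then show False using v *(1) unfolding f_vanish_def by blast
    next
      case 2
      then show False using f_extract[OF v, of i j] *(1) n2 d_ge2 by simp
    qed
  qed
  have "XF2 (i + a') b (i + j + e - 1)"
    using *(4) unfolding RW_def
  proof (elim disjE conjE)
    assume "a' = 0" "b = 0"
    then show ?thesis using f unfolding XF2_def by auto
  next
    assume "a' = 1" "b = 1" "d \<le> e"
    moreover then have "1 \<le> j" using *(5) by (cases j) auto
    moreover have "i = 0 \<or> i = 1 \<or> i = 2 \<and> d + 1 \<le> i + j \<or> d + 2 \<le> i + j" using f by linarith
    ultimately show ?thesis unfolding XF2_def by auto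
  next
    assume "a' = 2" "b = 2" "2 * d \<le> e"
    moreover then have "1 \<le> j" using *(5) by (cases j) auto
    ultimately show ?thesis using d_ge2 unfolding XF2_def by (cases "i = 0") auto
  next
    assume "3 * d \<le> e + 1"
    then show ?thesis using ij d_ge2 unfolding XF2_def by auto
  next
    assume "n \<le> e + 1"
    then show ?thesis using ij n2 unfolding XF2_def by auto
  qed
  then show "1 \<le> a + b + c \<and> XF2 a b (a + b + c - 1)" using w *(2,3) ij by simp
qed

text \<open>Coarser than sums of \<open>XF2\<close>: good monomials of \<open>r'\<close> other than
  z zbar u^m have degree at least 2d + 1, so the powers share an excess of at most d.\<close>

definition XP :: "nat \<Rightarrow> nat \<Rightarrow> nat \<Rightarrow> nat \<Rightarrow> bool" where
  "XP k a b e \<longleftrightarrow> a \<le> k \<and> b = 0 \<or> d \<le> e \<and> a + b \<le> k + 1 \<or> d + 1 \<le> e"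

text \<open>Only one factor can spend excess d and have degree 2 in (z, zbar) instead of 1; two such
  factors already exceed d.\<close>

lemma XP_add:
  assumes "XF2 a1 b1 e1" "XP k a2 b2 e2"
  shows "XP (Suc k) (a1 + a2) (b1 + b2) (e1 + e2)"
proof -
  have "a1 \<le> 1 \<and> b1 = 0 \<or> d \<le> e1 \<and> a1 + b1 \<le> 2 \<or> d + 1 \<le> e1"
    "a2 \<le> k \<and> b2 = 0 \<or> d \<le> e2 \<and> a2 + b2 \<le> k + 1 \<or> d + 1 \<le> e2"
    using assms d_ge2 unfolding XF2_def XP_def by linarith+
  then show ?thesis
    unfolding XP_def using d_ge2 by (elim disjE conjE) simp_all
qed

lemma sup_pow_F:
  assumes "2 * d + 2 \<le> n"
  shows "sup3 k (pow3 F k) (XP k)" and "sup3 k (pow3 (cnj3 F) k) (\<lambda>a b e. XP k b a e)"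
proof -
  show "sup3 k (pow3 F k) (XP k)"
    by (rule sup3_pow3[OF sup_F2[OF assms], of XP]) (simp add: XP_def, rule XP_add)
  show "sup3 k (pow3 (cnj3 F) k) (\<lambda>a b e. XP k b a e)"
    by (rule sup3_pow3[OF sup3_cnj3[OF sup_F2[OF assms]], of "\<lambda>k a b e. XP k b a e"])
      (simp add: XP_def, rule XP_add)
qed

lemma good_prod_stage2:
  assumes n2: "2 * d + 2 \<le> n" and r': "r' i j k \<noteq> 0" and nb: "\<not> bad d i j (i + j + k)"
    and w: "a + b + c = n" "i + j + k \<le> n"
    and nz: "mul3 (pow3 F i) (mul3 (pow3 (cnj3 F) j) (pow3 H k)) a b c \<noteq> 0"
  shows "\<not> bad d a b n"
proof (cases "i = 1 \<and> j = 1 \<and> k = m")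
  case True
  have "mul3 F (mul3 (cnj3 F) (pow3 H m)) a b c \<noteq> 0"
    using nz True by (simp add: mul3_one3_right)
  then obtain a1 b1 e1 a2 b2 e2 a3 b3 e3 where *: "XF2 a1 b1 e1" "XF2 b2 a2 e2" "XH a3 b3 e3"
    "a = a1 + a2 + a3" "b = b1 + b2 + b3" "a + b + c = 1 + 1 + m + e1 + e2 + e3"
    by (rule sup3_mul3_mul3D[OF sup_F2[OF n2] sup3_cnj3[OF sup_F2[OF n2]] sup_pow_H])
  have e: "n = d + 1 + (e1 + e2 + e3)" using *(6) w d_eq by linarith
  have e2d: "e1 + e2 + e3 \<le> 2 * d" using e n_le by linarith
  have F1: "a1 \<le> 1 \<and> b1 = 0 \<or> d \<le> e1 \<and> a1 + b1 \<le> 2 \<or> d + 1 \<le> e1 \<and> b1 = 0 \<or>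
      d + 1 \<le> e1 \<and> a1 \<le> 2 \<and> b1 \<le> 1 \<or> e1 = 2 * d \<and> (b1 \<le> 1 \<or> a1 \<le> 2 \<and> b1 \<le> 2)"
    using *(1) e2d unfolding XF2_def by linarith
  have F2: "b2 \<le> 1 \<and> a2 = 0 \<or> d \<le> e2 \<and> b2 + a2 \<le> 2 \<or> d + 1 \<le> e2 \<and> a2 = 0 \<or>
      d + 1 \<le> e2 \<and> b2 \<le> 2 \<and> a2 \<le> 1 \<or> e2 = 2 * d \<and> (a2 \<le> 1 \<or> b2 \<le> 2 \<and> a2 \<le> 2)"
    using *(2) e2d unfolding XF2_def by linarith
  have H3: "a3 = 0 \<and> b3 = 0 \<or> d \<le> e3 \<and> a3 \<le> 1 \<and> b3 \<le> 1 \<or> d + 1 \<le> e3 \<and> (a3 = 0 \<or> b3 = 0) \<or>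
      e3 = 2 * d \<and> a3 \<le> 2 \<and> b3 \<le> 2"
    using *(3) e e2d d_ge2 unfolding XH_def by linarith
  have "a \<le> 1 \<or> b \<le> 1 \<or> a \<le> 2 \<and> b \<le> 2 \<or>
      n = 3 * d + 1 \<and> (a + b \<le> 5 \<or> a \<le> 2 \<or> b \<le> 2 \<or> a \<le> 3 \<and> b \<le> 3)"
  proof -
    have N1: "a1 \<le> 1 \<and> b1 = 0 \<or> d \<le> e1" using F1 by linarith
    have N2: "b2 \<le> 1 \<and> a2 = 0 \<or> d \<le> e2" using F2 by linarith
    have N3: "a3 = 0 \<and> b3 = 0 \<or> d \<le> e3" using H3 by linarith
    \<comment> \<open>The total excess is at most 2d. If two factors need d each, the third has
      none, n = 3d + 1 and a + b <= 5; otherwise two factors are trivial and the third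
      decides.\<close>
    consider "a1 \<le> 1 \<and> b1 = 0" "b2 \<le> 1 \<and> a2 = 0" | "a1 \<le> 1 \<and> b1 = 0" "a3 = 0 \<and> b3 = 0"
      | "b2 \<le> 1 \<and> a2 = 0" "a3 = 0 \<and> b3 = 0"
      | "d \<le> e1" "d \<le> e2" | "d \<le> e1" "d \<le> e3" | "d \<le> e2" "d \<le> e3"
      using N1 N2 N3 by blast
    then show ?thesis
    proof cases
      case 1
      then show ?thesis using H3 e e2d *(4,5) n_le by linarith
    next
      case 2
      then show ?thesis using F2 e e2d *(4,5) n_le by linarith
    next
      case 3
      then show ?thesis using F1 e e2d *(4,5) n_le by linarith
    next
      case 4
      then have "e1 = d" "e2 = d" "e3 = 0" using e2d by linarith+
      moreover from this have "a1 + b1 \<le> 2" "a2 + b2 \<le> 2" "a3 + b3 = 0"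
        using F1 F2 H3 d_ge2 by auto
      ultimately show ?thesis using e *(4,5) by simp
    next
      case 5
      then have "e1 = d" "e2 = 0" "e3 = d" using e2d by linarith+
      moreover from this have "a1 + b1 \<le> 2" "a2 + b2 \<le> 1" "a3 + b3 \<le> 2"
        using F1 F2 H3 d_ge2 by auto
      ultimately show ?thesis using e *(4,5) by simp
    next
      case 6
      then have "e1 = 0" "e2 = d" "e3 = d" using e2d by linarith+
      moreover from this have "a1 + b1 \<le> 1" "a2 + b2 \<le> 2" "a3 + b3 \<le> 2"
        using F1 F2 H3 d_ge2 by auto
      ultimately show ?thesis using e *(4,5) by simp
    qed
  qed
  then show ?thesis using n2 unfolding bad_def by auto
next
  case False
  then have ge: "2 \<le> i" "2 \<le> j" using r'_supp[OF r'] by auto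
  obtain a1 b1 e1 a2 b2 e2 a3 b3 e3 where *: "XP i a1 b1 e1" "XP j b2 a2 e2" "XH a3 b3 e3"
    "a = a1 + a2 + a3" "b = b1 + b2 + b3" "a + b + c = i + j + k + e1 + e2 + e3"
    by (rule sup3_mul3_mul3D[OF sup_pow_F(1)[OF n2] sup_pow_F(2)[OF n2] sup_pow_H nz])
  \<comment> \<open>The excess left is at most d for (2,2), at most 1 for i + j = 5, and 0 from
    degree 3d + 1 on; below d it cannot raise the degrees beyond (i, j).\<close>
  show ?thesis
  proof (rule not_badE[OF ge nb])
    assume ij: "i = 2" "j = 2" "2 * d + 1 \<le> i + j + k"
    have e: "e1 + e2 + e3 \<le> d" using *(6) w n_le ij(3) by linarith
    have F1: "a1 \<le> 2 \<and> b1 = 0 \<or> e1 = d \<and> a1 + b1 \<le> 3"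
      using *(1) e ij unfolding XP_def by linarith
    have F2: "b2 \<le> 2 \<and> a2 = 0 \<or> e2 = d \<and> b2 + a2 \<le> 3"
      using *(2) e ij unfolding XP_def by linarith
    have H3: "a3 = 0 \<and> b3 = 0 \<or> e3 = d \<and> a3 \<le> 1 \<and> b3 \<le> 1"
      using *(3) e n2 d_ge2 unfolding XH_def by linarith
    have "a \<le> 2 \<and> b \<le> 2 \<or> 3 * d + 1 \<le> n \<and> (a \<le> 2 \<or> b \<le> 2 \<or> a \<le> 3 \<and> b \<le> 3)"
      using F1 F2 H3 e *(4,5,6) w ij d_ge2 by linarith
    then show ?thesis using n2 unfolding bad_def by auto
  next
    assume ij: "i + j = 5" "3 * d \<le> i + j + k"
    have e: "e1 + e2 + e3 < d" using *(6) w n_le ij(2) d_ge2 by linarith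
    have "a \<le> i" "b \<le> j"
      using *(1-5) e n2 unfolding XP_def XH_def by linarith+
    then show ?thesis using ij ge n2 w unfolding bad_def by auto
  next
    assume ij: "6 \<le> i + j" "i = 2 \<or> j = 2 \<or> i = 3 \<and> j = 3" "3 * d + 1 \<le> i + j + k"
    have e: "e1 + e2 + e3 = 0" using *(6) w n_le ij(3) by linarith
    have "a \<le> i" "b \<le> j"
      using *(1-5) e n2 d_ge2 unfolding XP_def XH_def by linarith+
    then show ?thesis using ij ge n2 w unfolding bad_def by auto
  next
    assume "3 * d + 2 \<le> i + j + k"
    then show ?thesis using w n_le by linarith
  qed
qed

lemma good_prod:
  assumes "r' i j k \<noteq> 0" "\<not> bad d i j (i + j + k)" "a + b + c = n" "i + j + k \<le> n" "bad d a b n"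
  shows "mul3 (pow3 F i) (mul3 (pow3 (cnj3 F) j) (pow3 H k)) a b c = 0"
proof (cases "n \<le> 2 * d + 1")
  case True
  then show ?thesis using good_prod_stage1[OF True assms(1-4)] assms(5) by blast
next
  case False
  then have "2 * d + 2 \<le> n" by simp
  from good_prod_stage2[OF this assms(1-4)] show ?thesis using assms(5) by blast
qed

section \<open>Comparison of the two series in degree n\<close>

lemma rhs_term_bad:
  assumes "a + b + c = n" "bad d a b n" "i + j + k \<le> n" "r' i j k \<noteq> 0"
    and "mul3 (pow3 F i) (mul3 (pow3 (cnj3 F) j) (pow3 H k)) a b c \<noteq> 0"
  shows "i + j + k = n \<and> bad d i j n \<and> a \<le> i \<and> b \<le> j"
proof -
  have "bad d i j (i + j + k)" using good_prod[OF assms(4) _ assms(1,3,2)] assms(5) by blast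
  moreover then have "i + j + k = n" using r'_good[OF assms(4)] assms(3) by (meson le_neq_implies_less)
  ultimately show ?thesis using lead_prod[OF assms(5)] assms(1) by simp
qed

lemma no_bad_source:
  assumes "\<And>i j k. r' i j k \<noteq> 0 \<Longrightarrow> \<not> bad d i j (i + j + k)"
    and "a + b + c = n" "bad d a b n"
  shows "r a b c = 0"
proof -
  have "comp3 r' F (cnj3 F) H a b c = 0"
  proof (rule ccontr)
    assume "comp3 r' F (cnj3 F) H a b c \<noteq> 0"
    then obtain i j k where *: "i + j + k \<le> a + b + c" "r' i j k \<noteq> 0"
      "mul3 (pow3 F i) (mul3 (pow3 (cnj3 F) j) (pow3 H k)) a b c \<noteq> 0"
      by (rule comp3_nonzeroE)
    then show False using rhs_term_bad[OF assms(2,3) _ *(2,3)] assms(1)[OF *(2)] assms(2) by auto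
  qed
  then show ?thesis using lhs_bad[OF assms(2,3)] g_01_nz by simp
qed

text \<open>Works with the same map, without forming an inverse: a bad monomial of \<open>r'\<close>
  with a + b maximal reaches \<open>r\<close> with a nonzero factor and cannot be cancelled.\<close>

lemma no_bad_target:
  assumes "\<And>a b c. r a b c \<noteq> 0 \<Longrightarrow> \<not> bad d a b (a + b + c)"
    and "i + j + k = n" "bad d i j n"
  shows "r' i j k = 0"
proof (rule ccontr)
  assume nz: "r' i j k \<noteq> 0"
  define P where "P t \<longleftrightarrow> (\<exists>i j k. i + j = t \<and> i + j + k = n \<and> bad d i j n \<and> r' i j k \<noteq> 0)" for t
  have "P (i + j)" using nz assms(2,3) unfolding P_def by blast
  moreover have "\<forall>t. P t \<longrightarrow> t \<le> n" unfolding P_def by auto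
  ultimately obtain t where t: "P t" "\<forall>t'. P t' \<longrightarrow> t' \<le> t"
    using GreatestI_nat[of P] Greatest_le_nat[of P] by metis
  then obtain a b c where abc: "a + b = t" "a + b + c = n" "bad d a b n" "r' a b c \<noteq> 0"
    unfolding P_def by blast
  have "comp3 r' F (cnj3 F) H a b c =
      r' a b c * mul3 (pow3 F a) (mul3 (pow3 (cnj3 F) b) (pow3 H c)) a b c"
  proof (rule comp3_single)
    fix i' j' k' assume *: "i' + j' + k' \<le> a + b + c" "r' i' j' k' \<noteq> 0"
      "mul3 (pow3 F i') (mul3 (pow3 (cnj3 F) j') (pow3 H k')) a b c \<noteq> 0"
    \<comment> \<open>Any other contributor dominates (a, b) componentwise, so maximality of a + b
      leaves only equality.\<close>
    have 1: "i' + j' + k' = n \<and> bad d i' j' n \<and> a \<le> i' \<and> b \<le> j'"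
      using rhs_term_bad[OF abc(2,3) _ *(2,3)] *(1) abc(2) by simp
    then have "P (i' + j')" using *(2) unfolding P_def by blast
    then have "i' + j' \<le> a + b" using t(2) abc(1) by blast
    then show "i' = a \<and> j' = b \<and> k' = c" using 1 abc(2) by linarith
  qed simp
  then have "r a b c \<noteq> 0" using lhs_bad[OF abc(2,3)] abc(4) prod_top_nz by auto
  then show False using assms(1) abc(2,3) by blast
qed

end

section \<open>Fuchsian type as absence of bad monomials\<close>

lemma ord_fps_ge: "enat N \<le> ord_fps p \<longleftrightarrow> (\<forall>j<N. fps_nth p j = 0)"
proof (cases "p = 0")
  case False
  then have "N \<le> subdegree p \<longleftrightarrow> (\<forall>j<N. fps_nth p j = 0)"
    by (meson nth_less_subdegree_zero order_less_le_trans subdegree_geI)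
  then show ?thesis using False by (simp add: ord_fps_def)
qed (simp add: ord_fps_def)

lemma nf_ser_supp:
  "nf_ser m eps h a b c \<noteq> 0 \<Longrightarrow> a = 1 \<and> b = 1 \<and> c = m \<or> 2 \<le> a \<and> 2 \<le> b \<and> m \<le> c"
  unfolding nf_ser_def by (auto split: if_splits)

lemma real3_nf_ser:
  assumes "hermitian_h h"
  shows "real3 (nf_ser m eps h)"
  unfolding real3_def
proof (intro allI)
  fix a b c
  have "fps_nth (h b a) (c - m) = cnj (fps_nth (h a b) (c - m))"
    using assms unfolding hermitian_h_def by blast
  then show "nf_ser m eps h b a c = cnj (nf_ser m eps h a b c)"
    unfolding nf_ser_def by simp
qed

text \<open>With c = m + j, each threshold on a + b + c becomes an order bound on
  \<open>h a b\<close>. Hermitian symmetry supplies the pairs (3,2) and (l,2), which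
  \<open>fuchsian\<close> lists only in the other order.\<close>

lemma fuchsian_iff_not_bad:
  assumes m: "1 \<le> m" and herm: "hermitian_h h"
  shows "fuchsian m h \<longleftrightarrow> (\<forall>a b c. nf_ser m eps h a b c \<noteq> 0 \<longrightarrow> \<not> bad (m + 1) a b (a + b + c))"
    (is "_ \<longleftrightarrow> ?R")
proof
  assume F: "fuchsian m h"
  have sym: "fps_nth (h b a) j = 0 \<longleftrightarrow> fps_nth (h a b) j = 0" for a b j
    using herm unfolding hermitian_h_def by (metis complex_cnj_zero_iff)
  have F22: "fps_nth (h 2 2) j = 0" if "j < m - 1" for j
    using F that unfolding fuchsian_def ord_fps_ge by blast
  have F23: "fps_nth (h 2 3) j = 0" if "j < 2 * m - 2" for j
    using F that unfolding fuchsian_def ord_fps_ge by blast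
  have F33: "fps_nth (h 3 3) j = 0" if "j < 2 * m - 2" for j
    using F that unfolding fuchsian_def ord_fps_ge by blast
  have F2l: "fps_nth (h 2 l) j = 0" if "4 \<le> l" "j < 2 * m + 2 - l" for l j
  proof -
    \<comment> \<open>For larger l the truncated difference is 0, so no j lies below it.\<close>
    have "l \<le> 2 * m + 1" using that by linarith
    then show ?thesis using F that unfolding fuchsian_def ord_fps_ge by blast
  qed
  have Fkl: "fps_nth (h k l) j = 0" if "3 \<le> k" "3 \<le> l" "7 \<le> k + l" "j < 2 * m + 5 - k - l" for k l j
  proof -
    have "k + l \<le> 2 * m + 4" using that by linarith
    then show ?thesis using F that unfolding fuchsian_def ord_fps_ge by blast
  qed
  show ?R
  proof (intro allI impI notI)
    fix a b c assume nz: "nf_ser m eps h a b c \<noteq> 0" and b: "bad (m + 1) a b (a + b + c)"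
    have ab: "2 \<le> a" "2 \<le> b" using b by (simp_all add: bad_def)
    then have c: "m \<le> c" and h: "fps_nth (h a b) (c - m) \<noteq> 0"
      using nz unfolding nf_ser_def by (auto split: if_splits)
    define j where "j = c - m"
    have w: "a + b + c = a + b + (m + j)" using c by (simp add: j_def)
    have "a = 2 \<or> a = 3 \<or> 4 \<le> a" "b = 2 \<or> b = 3 \<or> 4 \<le> b" using ab by linarith+
    then consider "a = 2 \<and> b = 2" | "a = 2 \<and> b = 3 \<or> a = 3 \<and> b = 2" | "a = 2" "4 \<le> b" | "b = 2" "4 \<le> a"
      | "a = 3 \<and> b = 3" | "3 \<le> a" "3 \<le> b" "7 \<le> a + b"
      by (elim disjE) simp_all
    then have "fps_nth (h a b) j = 0"
    proof cases
      case 1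
      then have "j < m - 1" using b unfolding w bad_def by simp
      then show ?thesis using F22 1 by simp
    next
      case 2
      then have "j < 2 * m - 2" using b unfolding w bad_def by auto
      then show ?thesis using F23 sym[of 2 3] 2 by auto
    next
      case 3
      then have "j < 2 * m + 2 - b" using b unfolding w bad_def by simp
      then show ?thesis using F2l 3 by simp
    next
      case 4
      then have "j < 2 * m + 2 - a" using b unfolding w bad_def by simp
      then show ?thesis using F2l sym[of a 2] 4 by simp
    next
      case 5
      then have "j < 2 * m - 2" using b unfolding w bad_def by simp
      then show ?thesis using F33 5 by simp
    next
      case 6
      then have "a + b + (m + j) < 3 * (m + 1) + 2" using b unfolding w bad_def by linarith
      then have "j < 2 * m + 5 - a - b" by (simp add: less_diff_conv)
      then show ?thesis using Fkl 6 by simp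
    qed
    then show False using h unfolding j_def by blast
  qed
next
  assume R: ?R
  have Z: "fps_nth (h a b) j = 0" if "bad (m + 1) a b (a + b + m + j)" for a b j
  proof -
    have "2 \<le> a" "2 \<le> b" using that by (simp_all add: bad_def)
    moreover have "nf_ser m eps h a b (m + j) = 0" using R that by (metis add.assoc)
    ultimately show ?thesis by (simp add: nf_ser_def)
  qed
  show "fuchsian m h"
    unfolding fuchsian_def ord_fps_ge
    by (intro conjI allI impI; rule Z; simp add: bad_def; linarith?)
qed

theorem theorem8p17:
  fixes m :: nat and eps eps' :: int and h h' :: "nat \<Rightarrow> nat \<Rightarrow> complex fps"
    and f g :: ser2
  assumes "m \<ge> 1"
    and "eps \<in> {1, -1}" and "eps' \<in> {1, -1}"
    and "hermitian_h h" and "hermitian_h h'"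
    and "\<exists>r0 f0 g0. r0 0 0 0 = 0 \<and> real3 r0 \<and> convergent3 r0 \<and>
           maps_hyp f0 g0 r0 (nf_ser m eps h)"
    and "maps_hyp f g (nf_ser m eps h) (nf_ser m eps' h')"
  shows "fuchsian m h \<longleftrightarrow> fuchsian m h'"
proof (rule ccontr)
  let ?r = "nf_ser m eps h" and ?r' = "nf_ser m eps' h'"
  \<comment> \<open>The least degree is taken over both series at once, so that both are good below
    it, as \<open>nf_map_good\<close> requires.\<close>
  define B where "B w \<longleftrightarrow> (\<exists>a b c. a + b + c = w \<and> bad (m + 1) a b w \<and> (?r a b c \<noteq> 0 \<or> ?r' a b c \<noteq> 0))"
    for w
  define n where "n = (LEAST w. B w)"
  note iff = fuchsian_iff_not_bad[OF assms(1,4), of eps] fuchsian_iff_not_bad[OF assms(1,5), of eps']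
  assume neq: "\<not> ?thesis"
  then have "\<exists>w. B w" using iff unfolding B_def by metis
  then have Bn: "B n" unfolding n_def by (rule LeastI_ex)
  have least: "\<not> B w" if "w < n" for w using that unfolding n_def by (rule not_less_Least)
  obtain a b c where abc: "a + b + c = n" "bad (m + 1) a b n" "?r a b c \<noteq> 0 \<or> ?r' a b c \<noteq> 0"
    using Bn unfolding B_def by blast
  interpret nf_map_good "m + 1" m ?r ?r' f g n
  proof
    show "?r' 1 1 m \<noteq> 0" using assms(3) by (auto simp: nf_ser_def)
    have "2 \<le> a" "2 \<le> b" using abc(2) by (simp_all add: bad_def)
    then show "m + 1 + 3 \<le> n" using abc(1,3) nf_ser_supp[of m _ _ a b c] by force
    show "n \<le> 3 * (m + 1) + 1" using abc(2) unfolding bad_def by linarith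
  qed (use assms nf_ser_supp real3_nf_ser least in \<open>auto simp: B_def\<close>)
  show False
  \<comment> \<open>Exactly one series is of Fuchsian type and has no bad monomial in any degree; so
    the violation in degree \<open>n\<close> lies in the other one, and the matching comparison
    lemma excludes it.\<close>
  proof (cases "fuchsian m h'")
    case True
    then have "?r' i j k = 0 \<or> \<not> bad (m + 1) i j (i + j + k)" for i j k using iff(2) by blast
    moreover from this have "?r a b c \<noteq> 0" using abc by metis
    ultimately show False using no_bad_source[OF _ abc(1,2)] by blast
  next
    case False
    then have "fuchsian m h" using neq by blast
    then have "?r i j k = 0 \<or> \<not> bad (m + 1) i j (i + j + k)" for i j k using iff(1) by blast
    moreover from this have "?r' a b c \<noteq> 0" using abc by metis
    ultimately show False using no_bad_target[OF _ abc(1,2)] by blast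
  qed
qed

end
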